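(* Let $\Phi:[0,\infty]\to[0,\infty]$ be a Young function, and let $1<q<\infty$. (1) If $\Phi\in\nabla_2$, then there is a constant $C>0$ such that $$\left\|\sup_{j\in\mathbb{N}}Mf_j\right\|_{{\rm w}L^\Phi}\le C\left\|\sup_{j\in\mathbb{N}}|f_j|\right\|_{{\rm w}L^\Phi}$$ for any sequence $\{f_j\}_{j=1}^\infty$ of measurable functions on $\mathbb{R}^n$. (2) If $\Phi\in\Delta_2\cap\nabla_2$, then there is a constant $C>0$ such that $$\left\|\left(\sum_{j=1}^\infty(Mf_j)^q\right)^{1/q}\right\|_{{\rm w}L^\Phi}\le C\left\|\left(\sum_{j=1}^\infty|f_j|^q\right)^{1/q}\right\|_{{\rm w}L^\Phi}$$ for any sequence $\{f_j\}_{j=1}^\infty$ of measurable functions on $\mathbb{R}^n$.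
   Context: For $\Phi:[0,\infty]\to[0,\infty]$ put $a(\Phi)=\sup\{t\ge0:\Phi(t)=0\}$ and $b(\Phi)=\inf\{t\ge0:\Phi(t)=\infty\}$, with $\inf\emptyset=\infty$. An increasing (i.e. non-decreasing) function $\Phi:[0,\infty]\to[0,\infty]$ is a Young function if: (1) $0\le a(\Phi)<\infty$ and $0<b(\Phi)\le\infty$; (2) $\lim_{t\to0}\Phi(t)=\Phi(0)=0$; (3) $\Phi$ is convex on $[0,b(\Phi))$; (4) if $b(\Phi)=\infty$ then $\lim_{t\to\infty}\Phi(t)=\Phi(\infty)=\infty$; (5) if $b(\Phi)<\infty$ then $\lim_{t\to b(\Phi)-0}\Phi(t)=\Phi(b(\Phi))$. $\Phi\in\Delta_2$ means that for some $k>1$, $\Phi(2r)\le k\Phi(r)$ for all $r>0$. $\Phi\in\nabla_2$ means that for some $k>1$, $\Phi(r)\le\frac1{2k}\Phi(kr)$ for all $r\ge0$. For a measurable function $f$ on $\mathbb{R}^n$ and $t>0$, $m(f,t)=|\{x\in\mathbb{R}^n:|f(x)|>t\}|$, and $\|f\|_{{\rm w}L^\Phi}=\inf\{\lambda>0:\sup_{t>0}\Phi(t)m(f/\lambda,t)\le1\}$, with $\inf\emptyset=\infty$ and the convention $0\cdot\infty=0$; the same formula is used for $[0,\infty]$-valued measurable functions. The Hardy-Littlewood maximal operator is $Mf(x)=\sup_{Q}\frac{\chi_Q(x)}{|Q|}\int_Q|f(y)|\,dy$, the supremum being over all cubes $Q\subset\mathbb{R}^n$ with sides parallel to the coordinate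 axes. The constants $C$ do not depend on the sequence $\{f_j\}$ (they may depend on $\Phi,n,q$). *)

theory Defs
  imports "HOL-Analysis.Analysis"
begin

definition a_index :: "(ennreal \<Rightarrow> ennreal) \<Rightarrow> ennreal" where
  "a_index \<Phi> = Sup {t. \<Phi> t = 0}"

definition b_index :: "(ennreal \<Rightarrow> ennreal) \<Rightarrow> ennreal" where
  "b_index \<Phi> = Inf {t. \<Phi> t = \<infinity>}"

(* Passing to the reals with enn2real in the convexity condition loses nothing:
   \<Phi> is finite below b_index \<Phi>. *)
definition young_function :: "(ennreal \<Rightarrow> ennreal) \<Rightarrow> bool" where
  "young_function \<Phi> \<longleftrightarrow>
     mono \<Phi> \<and>
     (a_index \<Phi> < \<infinity> \<and> 0 < b_index \<Phi>) \<and>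
     ((\<Phi> \<longlongrightarrow> \<Phi> 0) (at_right 0) \<and> \<Phi> 0 = 0) \<and>
     convex_on {t::real. 0 \<le> t \<and> ennreal t < b_index \<Phi>} (\<lambda>t. enn2real (\<Phi> (ennreal t))) \<and>
     (b_index \<Phi> = \<infinity> \<longrightarrow> (\<Phi> \<longlongrightarrow> \<Phi> \<infinity>) (at_left \<infinity>) \<and> \<Phi> \<infinity> = \<infinity>) \<and>
     (b_index \<Phi> < \<infinity> \<longrightarrow> (\<Phi> \<longlongrightarrow> \<Phi> (b_index \<Phi>)) (at_left (b_index \<Phi>)))"

definition Delta2 :: "(ennreal \<Rightarrow> ennreal) \<Rightarrow> bool" where
  "Delta2 \<Phi> \<longleftrightarrow>
     (\<exists>k::real. k > 1 \<and> (\<forall>r::real. r > 0 \<longrightarrow> \<Phi> (ennreal (2 * r)) \<le> ennreal k * \<Phi> (ennreal r)))"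

definition nabla2 :: "(ennreal \<Rightarrow> ennreal) \<Rightarrow> bool" where
  "nabla2 \<Phi> \<longleftrightarrow>
     (\<exists>k::real. k > 1 \<and>
       (\<forall>r::real. r \<ge> 0 \<longrightarrow> \<Phi> (ennreal r) \<le> ennreal (1 / (2 * k)) * \<Phi> (ennreal (k * r))))"

definition distrib_fun :: "(real ^ 'n \<Rightarrow> ennreal) \<Rightarrow> real \<Rightarrow> ennreal" where
  "distrib_fun g t = emeasure lebesgue {x. g x > ennreal t}"

(* Stated for [0,\<infinity>]-valued functions; for scalar f take g = |f|.
   In ennreal, Inf {} = \<infinity> and 0 * \<infinity> = 0. *)
definition weak_orlicz_norm :: "(ennreal \<Rightarrow> ennreal) \<Rightarrow> (real ^ 'n \<Rightarrow> ennreal) \<Rightarrow> ennreal" where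
  "weak_orlicz_norm \<Phi> g =
     Inf {ennreal l | l::real. l > 0 \<and>
            (SUP t\<in>{0<..}. \<Phi> (ennreal t) * distrib_fun (\<lambda>x. g x / ennreal l) t) \<le> 1}"

definition cubes :: "(real ^ 'n) set set" where
  "cubes = {cbox c (c + (\<chi> i. l)) | c l. l > 0}"

definition maximal_fun :: "(real ^ 'n \<Rightarrow> complex) \<Rightarrow> real ^ 'n \<Rightarrow> ennreal" where
  "maximal_fun f x =
     (SUP Q\<in>cubes. indicator Q x / emeasure lebesgue Q *
        (\<integral>\<^sup>+ y\<in>Q. ennreal (cmod (f y)) \<partial>lebesgue))"

(* Only meant for exponents p > 0. *)
definition epowr :: "ennreal \<Rightarrow> real \<Rightarrow> ennreal" where
  "epowr x p = (if x = \<infinity> then \<infinity> else ennreal (enn2real x powr p))"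

end

theory Submission
  imports Defs
begin

text \<open>Every cube lies in a comparable cell of one of $2^n$ triadic grids, so the maximal operator may be
  replaced by maximal operators over laminar families. These satisfy weighted weak and strong type bounds
  with respect to every measure, with no doubling condition: the maximal cells of a finite subfamily are
  disjoint.

  Let $F$ be the supremum, respectively the $\ell^q$ norm, of the sequence, normalised by
  $\Phi(t) m(F,t) \le 1$. The condition $\nabla_2$ gives $\Phi(t) \int_{F>t} F \le 2kt$, and $\Delta_2$ gives
  $\Phi(t) \int_{F \le t} (F/t)^a \le 2d$ for large $a$. The first bound and the weak type inequality prove
  part (1). For part (2) the level $t$ is fixed and Lebesgue measure is replaced by the measure with
  density $F + t$. Off a set of size $O(1/\Phi(t))$ this change costs only a factor $3t$ in the averages,
  and Stein's inequality $\int (Mf)^q v \le C \int f^q Mv$ for the new measure, tested on the level set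
  itself, bounds the $\ell^q$ level set by the two integrals above. Finally $\nabla_2$ turns any bound
  $\Phi(t) m(G,bt) \le S$ into one with $S = 1$ and a larger $b$.\<close>

subsection \<open>Real powers of extended nonnegative reals\<close>

text \<open>The density F + t need not be doubling; this is why bounds valid for every measure are
  required. Its two summands have separate tasks. Because of F, the quotients of the sequence by F +
  t have \<ell>^q norm at most 1, so the exponent q can be raised to qp, and qp can be taken large
  enough for \<open>Delta2\<close> to control the small values of F. Because of t, a set has
  Lebesgue measure at most 1/t times its new measure, and the new measure stays comparable to t
  times Lebesgue measure on the cells around any point where the maximal function of F is at most
  2t. The exponent is raised by Young's inequality, which leaves a power of the maximal function of
  the indicator of the level set. Its integral is again a multiple of t times the size of that set
  and is absorbed into the left side; this subtraction needs finite measure, so the level set is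
  exhausted by pieces of finite measure. In part (1) a single function F dominates the whole
  sequence, and the scalar weak type bound is enough.\<close>

lemma epowr_top [simp]: "epowr top p = top"
  by (simp add: epowr_def)

lemma epowr_ennreal [simp]: "0 \<le> x \<Longrightarrow> epowr (ennreal x) p = ennreal (x powr p)"
  by (simp add: epowr_def)

lemma epowr_0 [simp]: "epowr 0 p = 0"
  by (simp add: epowr_def)

lemma epowr_one [simp]: "epowr 1 p = 1"
  by (simp add: epowr_def)

lemma epowr_1_right [simp]: "epowr x 1 = x"
  by (cases x) auto

lemma epowr_mono: "x \<le> y \<Longrightarrow> 0 \<le> p \<Longrightarrow> epowr x p \<le> epowr y p"
  by (cases x; cases y) (auto intro!: ennreal_leI powr_mono2 simp: top_unique)

lemma epowr_epowr: "epowr (epowr x p) r = epowr x (p * r)"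
  by (cases x) (auto simp: powr_powr)

text \<open>The conventions \<open>epowr 0 p = 0\<close> and \<open>epowr top p = top\<close> for
  every p keep the rule free of sign conditions; the case of a zero factor is separate because 0 *
  top = 0.\<close>

lemma epowr_mult: "epowr (x * y) p = epowr x p * epowr y p"
proof (cases "x = 0 \<or> y = 0")
  case False
  then show ?thesis
    by (cases x; cases y)
      (auto simp: ennreal_mult[symmetric] powr_mult ennreal_mult_top ennreal_top_mult)
qed auto

lemma epowr_le_iff: "0 < p \<Longrightarrow> epowr x p \<le> y \<longleftrightarrow> x \<le> epowr y (1 / p)"
  using epowr_mono[of "epowr x p" y "1 / p"] epowr_mono[of x "epowr y (1 / p)" p]
  by (auto simp: epowr_epowr)

lemma epowr_add_exponent: "0 < p \<Longrightarrow> 0 < r \<Longrightarrow> epowr x (p + r) = epowr x p * epowr x r"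
  by (cases x) (auto simp: powr_add ennreal_mult)

lemma borel_measurable_epowr [measurable (raw)]:
  "f \<in> borel_measurable M \<Longrightarrow> (\<lambda>x. epowr (f x) p) \<in> borel_measurable M"
proof -
  assume [measurable]: "f \<in> borel_measurable M"
  have "epowr y p = (if top \<le> y then top else ennreal (enn2real y powr p))" for y
    by (auto simp: epowr_def top_unique)
  then show ?thesis by simp
qed

text \<open>Young's inequality without the factors 1/p: either v is at most u^(p-1), and the product
  is at most u^p, or u is at most v^(1/(p-1)).\<close>

lemma mult_le_epowr_add:
  assumes "1 < p"
  shows "u * v \<le> epowr u p + epowr v (p / (p - 1))"
proof (cases "v \<le> epowr u (p - 1)")
  case True
  then have "u * v \<le> epowr u 1 * epowr u (p - 1)"
    by (simp add: mult_left_mono)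
  also have "\<dots> = epowr u p"
    using assms by (subst epowr_add_exponent[symmetric]) auto
  finally show ?thesis
    by (simp add: add_increasing2)
next
  case False
  then have "epowr u (p - 1) \<le> v" by simp
  then have "u \<le> epowr v (1 / (p - 1))"
    using assms by (subst (asm) epowr_le_iff) auto
  then have "u * v \<le> epowr v (1 / (p - 1)) * epowr v 1"
    by (simp add: mult_right_mono)
  also have "\<dots> = epowr v (p / (p - 1))"
    using assms by (subst epowr_add_exponent[symmetric]) (auto simp: field_simps)
  finally show ?thesis
    by (simp add: add_increasing)
qed

lemma nn_integral_powr_lessThan:
  assumes "-1 < a" "0 \<le> c"
  shows "(\<integral>\<^sup>+ s. ennreal (s powr a) * indicator {0<..<c} s \<partial>lborel) = ennreal (c powr (a + 1) / (a + 1))"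
proof -
  have "(\<integral>\<^sup>+ s. ennreal (s powr a) * indicator {0<..<c} s \<partial>lborel)
      = (\<integral>\<^sup>+ s. ennreal (indicator {0..c} s * s powr a) \<partial>lborel)"
    by (rule nn_integral_cong_AE) (use AE_lborel_singleton[of 0] AE_lborel_singleton[of c] in
      \<open>eventually_elim, auto simp: indicator_def\<close>)
  also have "\<dots> = ennreal (c powr (a + 1) / (a + 1))"
    using nn_integral_has_integral_lebesgue[OF _ has_integral_powr_from_0[OF assms]] by simp
  finally show ?thesis .
qed

lemma epowr_layer_cake:
  assumes "0 < p"
  shows "epowr y p \<le> (\<integral>\<^sup>+ s. ennreal (p * s powr (p - 1)) * indicator {s. 0 < s \<and> ennreal s < y} s \<partial>lborel)"
    (is "_ \<le> ?I y")
proof -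
  have *: "ennreal (c powr p) = ?I (ennreal c)" if "0 \<le> c" for c
  proof -
    have "?I (ennreal c) = (\<integral>\<^sup>+ s. ennreal p * (ennreal (s powr (p - 1)) * indicator {0<..<c} s) \<partial>lborel)"
      using assms that by (intro nn_integral_cong) (auto simp: indicator_def ennreal_mult ennreal_less_iff)
    also have "\<dots> = ennreal p * ennreal (c powr p / p)"
      using assms that nn_integral_powr_lessThan[of "p - 1" c] by (subst nn_integral_cmult) auto
    also have "\<dots> = ennreal (c powr p)"
      using assms by (simp add: ennreal_mult[symmetric])
    finally show ?thesis ..
  qed
  show ?thesis
  proof (cases y)
    case (real r)
    then show ?thesis using * by simp
  next
    case top
    \<comment> \<open>The levels below \<open>c powr (1 / p)\<close> alone contribute c, and c is
      arbitrary.\<close>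
    have "ennreal c \<le> ?I y" if "0 < c" for c
    proof -
      have "ennreal c = ennreal ((c powr (1 / p)) powr p)"
        using assms that by (simp add: powr_powr)
      also have "\<dots> \<le> ?I y"
        unfolding * [of "c powr (1 / p)", simplified]
        by (intro nn_integral_mono mult_left_mono) (auto simp: indicator_def top)
      finally show ?thesis .
    qed
    then have "?I y = top"
    proof (rule_tac ccontr)
      assume I: "\<And>c. 0 < c \<Longrightarrow> ennreal c \<le> ?I y" and "?I y \<noteq> top"
      then obtain r where r: "0 \<le> r" "?I y = ennreal r" by (cases "?I y") auto
      then show False using I[of "r + 1"] by simp
    qed
    then show ?thesis by simp
  qed
qed

subsection \<open>Maximal functions over laminar families\<close>

text \<open>By the conventions $0/0 = x/\infty = 0$, sets of measure $0$ or $\infty$ do not contribute to the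
  maximal function.\<close>

definition average :: "'a measure \<Rightarrow> ('a \<Rightarrow> ennreal) \<Rightarrow> 'a set \<Rightarrow> ennreal" where
  "average M f Q = (\<integral>\<^sup>+ x\<in>Q. f x \<partial>M) / emeasure M Q"

definition max_over :: "'a set set \<Rightarrow> 'a measure \<Rightarrow> ('a \<Rightarrow> ennreal) \<Rightarrow> 'a \<Rightarrow> ennreal" where
  "max_over D M f x = (SUP Q\<in>D. average M f Q * indicator Q x)"

definition laminar :: "'a set set \<Rightarrow> bool" where
  "laminar D \<longleftrightarrow> (\<forall>P\<in>D. \<forall>Q\<in>D. P \<inter> Q = {} \<or> P \<subseteq> Q \<or> Q \<subseteq> P)"

lemma laminar_subset: "laminar D \<Longrightarrow> E \<subseteq> D \<Longrightarrow> laminar E"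
  unfolding laminar_def by blast

text \<open>Finiteness puts every member below an inclusion-maximal one, and distinct maximal
  members cannot be nested.\<close>

lemma laminar_finite_disjoint_cover:
  assumes "finite S" "laminar S"
  obtains T where "T \<subseteq> S" "disjoint T" "\<Union>T = \<Union>S"
proof
  define T where "T = {Q\<in>S. \<forall>P\<in>S. Q \<subseteq> P \<longrightarrow> Q = P}"
  show "T \<subseteq> S" by (auto simp: T_def)
  show "disjoint T"
  proof (rule disjointI)
    fix P Q assume PQ: "P \<in> T" "Q \<in> T" "P \<noteq> Q"
    then have "P \<inter> Q = {} \<or> P \<subseteq> Q \<or> Q \<subseteq> P"
      using assms(2) by (simp add: laminar_def T_def)
    then show "P \<inter> Q = {}"
      using PQ by (auto simp: T_def)
  qed
  have "\<exists>P\<in>T. Q \<subseteq> P" if "Q \<in> S" for Q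
    using finite_has_maximal2[OF assms(1) that] unfolding T_def by blast
  then show "\<Union>T = \<Union>S"
    using \<open>T \<subseteq> S\<close> by blast
qed

lemma average_le_max_over: "Q \<in> D \<Longrightarrow> x \<in> Q \<Longrightarrow> average M f Q \<le> max_over D M f x"
  unfolding max_over_def by (rule SUP_upper2[of Q]) auto

lemma less_max_over_iff: "s < max_over D M f x \<longleftrightarrow> (\<exists>Q\<in>D. x \<in> Q \<and> s < average M f Q)"
  by (auto simp: max_over_def less_SUP_iff indicator_def)

lemma max_over_le_iff: "max_over D M f x \<le> s \<longleftrightarrow> (\<forall>Q\<in>D. x \<in> Q \<longrightarrow> average M f Q \<le> s)"
  by (meson less_max_over_iff not_less)

lemma borel_measurable_max_over [measurable]:
  assumes "countable D" "D \<subseteq> sets M"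
  shows "max_over D M f \<in> borel_measurable M"
  unfolding max_over_def using assms by (intro borel_measurable_SUP) auto

lemma less_averageD:
  assumes "s < average M f Q" and [measurable]: "Q \<in> sets M" "f \<in> borel_measurable M"
  shows "0 < emeasure M Q" "emeasure M Q < top"
proof -
  have "emeasure M Q \<noteq> 0"
  proof
    assume "emeasure M Q = 0"
    then have "(\<integral>\<^sup>+ x\<in>Q. f x \<partial>M) = 0"
      by (intro nn_integral_null_set) auto
    then show False using assms(1) by (simp add: average_def)
  qed
  then show "0 < emeasure M Q" by (simp add: zero_less_iff_neq_zero)
  show "emeasure M Q < top"
    using assms(1) by (auto simp: average_def less_top[symmetric])
qed

text \<open>A Fefferman-Stein inequality with constant 1. On a single cell it rests on a symmetry:
  the average of f times the integral of v equals the integral of f times the average of v.\<close>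

lemma max_over_weak_type:
  assumes "countable D" "D \<subseteq> sets M" "laminar D"
    and [measurable]: "f \<in> borel_measurable M" "v \<in> borel_measurable M"
  shows "s * (\<integral>\<^sup>+ x. v x * indicator {x. s < max_over D M f x} x \<partial>M) \<le> (\<integral>\<^sup>+ x. f x * max_over D M v x \<partial>M)"
proof -
  define D' where "D' = {Q\<in>D. s < average M f Q}"
  have D': "countable D'" "D' \<subseteq> sets M" "laminar D'"
    using assms laminar_subset[of D D'] by (auto simp: D'_def)
  have eq: "{x. s < max_over D M f x} = \<Union>D'"
    by (auto simp: D'_def less_max_over_iff)
  note [measurable] = borel_measurable_max_over[OF assms(1,2)]
  define V where "V = density M v"
  define W where "W = density M (\<lambda>x. f x * max_over D M v x)"
  have V: "emeasure V A = (\<integral>\<^sup>+ x. v x * indicator A x \<partial>M)" if "A \<in> sets M" for A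
    using that by (simp add: V_def emeasure_density)
  have one: "s * emeasure V Q \<le> emeasure W Q" if "Q \<in> D'" for Q
  proof -
    have Q [measurable]: "Q \<in> sets M" "Q \<in> D" "s < average M f Q"
      using that D' by (auto simp: D'_def)
    have "s * emeasure V Q \<le> average M f Q * (\<integral>\<^sup>+ x\<in>Q. v x \<partial>M)"
      using Q by (simp add: V mult_right_mono)
    also have "\<dots> = (\<integral>\<^sup>+ x\<in>Q. f x \<partial>M) * average M v Q"
      by (simp add: average_def divide_ennreal_def mult_ac)
    also have "\<dots> = (\<integral>\<^sup>+ x. f x * indicator Q x * average M v Q \<partial>M)"
      by (subst nn_integral_multc) auto
    also have "\<dots> \<le> (\<integral>\<^sup>+ x. f x * max_over D M v x * indicator Q x \<partial>M)"
      using average_le_max_over[OF Q(2), of _ M v]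
      by (intro nn_integral_mono) (auto simp: indicator_def intro!: mult_left_mono)
    also have "\<dots> = emeasure W Q"
      unfolding W_def by (subst emeasure_density) auto
    finally show ?thesis .
  qed
  \<comment> \<open>In an infinite family an increasing chain may have no maximal cell. Finite
    subfamilies come first, and continuity from below gives the whole union.\<close>
  have fin: "s * emeasure V (\<Union>S) \<le> (\<integral>\<^sup>+ x. f x * max_over D M v x \<partial>M)" if S: "finite S" "S \<subseteq> D'" for S
  proof -
    obtain T where T: "T \<subseteq> S" "disjoint T" "\<Union>T = \<Union>S"
      using laminar_finite_disjoint_cover[OF \<open>finite S\<close> laminar_subset[OF D'(3) S(2)]] by blast
    have fT: "finite T" "T \<subseteq> sets M" "T \<subseteq> D'"
      using T S finite_subset D' by auto
    have sum: "emeasure N (\<Union>T) = (\<Sum>Q\<in>T. emeasure N Q)" if "sets N = sets M" for N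
      using sum_emeasure[of "\<lambda>Q. Q" T N] fT that T(2)
      by (simp add: disjoint_def disjoint_family_on_def)
    have "s * emeasure V (\<Union>S) = (\<Sum>Q\<in>T. s * emeasure V Q)"
      using sum[of V] T by (simp add: V_def sum_distrib_left)
    also have "\<dots> \<le> (\<Sum>Q\<in>T. emeasure W Q)"
      using fT by (intro sum_mono one) auto
    also have "\<dots> = emeasure W (\<Union>T)"
      using sum[of W] by (simp add: W_def)
    also have "\<dots> \<le> emeasure W (space M)"
      using fT by (intro emeasure_mono) (auto simp: W_def dest: sets.sets_into_space)
    also have "\<dots> = (\<integral>\<^sup>+ x. f x * max_over D M v x \<partial>M)"
      unfolding W_def by (subst emeasure_density) (auto intro!: nn_integral_cong)
    finally show ?thesis .
  qed
  show ?thesis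
  proof (cases "D' = {}")
    case True
    then show ?thesis by (simp add: eq)
  next
    case False
    define S where "S n = from_nat_into D' ` {..n}" for n :: nat
    have S: "finite (S n)" "S n \<subseteq> D'" for n
      using from_nat_into[OF False] by (auto simp: S_def)
    have "\<Union>D' = (\<Union>n. \<Union>(S n))"
      using arg_cong[OF range_from_nat_into[OF False D'(1)], of Union] by (auto simp: S_def)
    moreover have "range (\<lambda>n. \<Union>(S n)) \<subseteq> sets V"
    proof safe
      fix n show "\<Union>(S n) \<in> sets V"
        using S[of n] D'(2) by (auto simp: V_def intro!: sets.finite_Union)
    qed
    moreover have "incseq (\<lambda>n. \<Union>(S n))"
      by (intro incseq_SucI Union_mono) (auto simp: S_def)
    ultimately have "(SUP n. emeasure V (\<Union>(S n))) = emeasure V (\<Union>D')"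
      using SUP_emeasure_incseq[of "\<lambda>n. \<Union>(S n)" V] by simp
    then have "s * emeasure V (\<Union>D') = (SUP n. s * emeasure V (\<Union>(S n)))"
      by (subst SUP_mult_left_ennreal[symmetric]) (rule arg_cong, rule sym)
    also have "\<dots> \<le> (\<integral>\<^sup>+ x. f x * max_over D M v x \<partial>M)"
      using S by (intro SUP_least fin)
    finally show ?thesis
      unfolding eq V[OF sets.countable_Union[OF D'(1,2)], symmetric] .
  qed
qed

text \<open>The part of f below height s adds at most s to any average, so an average above 2s
  leaves more than s to the part above. Removing the low part is what makes the integral over s in
  the strong type bound converge.\<close>

lemma max_over_weak_type_truncated:
  assumes "countable D" "D \<subseteq> sets M" "laminar D"
    and [measurable]: "f \<in> borel_measurable M" "v \<in> borel_measurable M" and "s < top"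
  shows "s * (\<integral>\<^sup>+ x. v x * indicator {x. 2 * s < max_over D M f x} x \<partial>M)
    \<le> (\<integral>\<^sup>+ x. f x * indicator {x. s < f x} x * max_over D M v x \<partial>M)"
proof -
  let ?g = "\<lambda>x. f x * indicator {x. s < f x} x"
  note [measurable] = borel_measurable_max_over[OF assms(1,2)]
  have "s < max_over D M ?g x" if "2 * s < max_over D M f x" for x
  proof -
    obtain Q where Q: "Q \<in> D" "x \<in> Q" "2 * s < average M f Q"
      using \<open>2 * s < max_over D M f x\<close> by (auto simp: less_max_over_iff)
    have [measurable]: "Q \<in> sets M" using Q assms by auto
    have pos: "0 < emeasure M Q" "emeasure M Q < top"
      using less_averageD[OF Q(3)] by auto
    have "(\<integral>\<^sup>+ x\<in>Q. f x \<partial>M) \<le> (\<integral>\<^sup>+ x. ?g x * indicator Q x + s * indicator Q x \<partial>M)"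
      by (intro nn_integral_mono) (auto simp: indicator_def)
    also have "\<dots> = (\<integral>\<^sup>+ x\<in>Q. ?g x \<partial>M) + s * emeasure M Q"
      by (subst nn_integral_add) (auto simp: nn_integral_cmult_indicator)
    finally have "average M f Q \<le> ((\<integral>\<^sup>+ x\<in>Q. ?g x \<partial>M) + s * emeasure M Q) / emeasure M Q"
      unfolding average_def by (rule divide_right_mono_ennreal)
    also have "\<dots> = average M ?g Q + s"
      using pos by (simp add: average_def add_divide_distrib_ennreal mult_divide_eq_ennreal)
    finally have "s + s < s + average M ?g Q"
      using Q(3) by (simp add: mult_2 add.commute order_less_le_trans)
    then have "s < average M ?g Q"
      by (simp add: ennreal_add_left_cancel_less)
    then show ?thesis using Q by (auto simp: less_max_over_iff)
  qed
  then have "s * (\<integral>\<^sup>+ x. v x * indicator {x. 2 * s < max_over D M f x} x \<partial>M)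
     \<le> s * (\<integral>\<^sup>+ x. v x * indicator {x. s < max_over D M ?g x} x \<partial>M)"
    by (intro mult_left_mono nn_integral_mono) (auto simp: indicator_def)
  also have "\<dots> \<le> (\<integral>\<^sup>+ x. ?g x * max_over D M v x \<partial>M)"
    by (intro max_over_weak_type assms) auto
  finally show ?thesis .
qed

text \<open>This is the inner integral left after Fubini in the strong type bound. For finite y it
  is y * 2q (2y)^(q-1) / (q-1), and q > 1 gives convergence at 0.\<close>

lemma epowr_inner_layer:
  assumes "1 < q"
  shows "y * (\<integral>\<^sup>+ s. ennreal (2 * q * s powr (q - 2)) * indicator {s. 0 < s \<and> ennreal (s / 2) < y} s \<partial>lborel)
    \<le> ennreal (q * 2 powr q / (q - 1)) * epowr y q"
proof (cases y)
  case top
  then show ?thesis using assms by (simp add: ennreal_mult_top)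
next
  case (real r)
  have "(\<integral>\<^sup>+ s. ennreal (2 * q * s powr (q - 2)) * indicator {s. 0 < s \<and> ennreal (s / 2) < y} s \<partial>lborel)
    = (\<integral>\<^sup>+ s. ennreal (2 * q) * (ennreal (s powr (q - 2)) * indicator {0<..<2 * r} s) \<partial>lborel)"
    using assms real by (intro nn_integral_cong) (auto simp: indicator_def ennreal_mult ennreal_less_iff)
  also have "\<dots> = ennreal (2 * q) * ennreal ((2 * r) powr (q - 1) / (q - 1))"
    using assms real nn_integral_powr_lessThan[of "q - 2" "2 * r"]
    by (subst nn_integral_cmult) auto
  finally have "y * (\<integral>\<^sup>+ s. ennreal (2 * q * s powr (q - 2)) * indicator {s. 0 < s \<and> ennreal (s / 2) < y} s \<partial>lborel)
     = ennreal (r * (2 * q * ((2 * r) powr (q - 1) / (q - 1))))"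
    using assms real by (simp add: ennreal_mult[symmetric])
  also have "r * (2 * q * ((2 * r) powr (q - 1) / (q - 1))) = q / (q - 1) * ((2 * r) powr 1 * (2 * r) powr (q - 1))"
    using real by simp
  also have "\<dots> = q / (q - 1) * (2 powr q * r powr q)"
    using real by (subst powr_add[symmetric]) (simp add: powr_mult)
  also have "ennreal \<dots> = ennreal (q * 2 powr q / (q - 1)) * epowr y q"
    using assms real by (simp add: ennreal_mult[symmetric])
  finally show ?thesis by simp
qed

text \<open>The truncated weak type bound at height s/2 is integrated against q s^(q-1) ds; at each
  x only the levels s < 2 f(x) survive. The free weight v allows both the dual use with an indicator
  and the unweighted use with v = 1.\<close>

lemma max_over_strong_type:
  assumes "sigma_finite_measure M" "countable D" "D \<subseteq> sets M" "laminar D" "1 < q"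
    and [measurable]: "f \<in> borel_measurable M" "v \<in> borel_measurable M"
  shows "(\<integral>\<^sup>+ x. epowr (max_over D M f x) q * v x \<partial>M)
    \<le> ennreal (q * 2 powr q / (q - 1)) * (\<integral>\<^sup>+ x. epowr (f x) q * max_over D M v x \<partial>M)"
proof -
  interpret M: sigma_finite_measure M by fact
  interpret pair_sigma_finite M lborel ..
  note [measurable] = borel_measurable_max_over[OF assms(2,3)]
  let ?F = "max_over D M f" and ?V = "max_over D M v"
  have "(\<integral>\<^sup>+ x. epowr (?F x) q * v x \<partial>M)
    \<le> (\<integral>\<^sup>+ x. (\<integral>\<^sup>+ s. ennreal (q * s powr (q - 1)) * indicator {s. 0 < s \<and> ennreal s < ?F x} s \<partial>lborel) * v x \<partial>M)"
    using assms(5) by (intro nn_integral_mono mult_right_mono epowr_layer_cake) auto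
  also have "\<dots> = (\<integral>\<^sup>+ x. (\<integral>\<^sup>+ s. ennreal (q * s powr (q - 1)) * indicator {s. 0 < s \<and> ennreal s < ?F x} s * v x \<partial>lborel) \<partial>M)"
    by (intro nn_integral_cong nn_integral_multc[symmetric]) measurable
  also have "\<dots> = (\<integral>\<^sup>+ s. (\<integral>\<^sup>+ x. ennreal (q * s powr (q - 1)) * indicator {s. 0 < s \<and> ennreal s < ?F x} s * v x \<partial>M) \<partial>lborel)"
    by (rule Fubini'[symmetric]) measurable
  also have "\<dots> \<le> (\<integral>\<^sup>+ s. (\<integral>\<^sup>+ x. f x * (ennreal (2 * q * s powr (q - 2)) * indicator {s. 0 < s \<and> ennreal (s / 2) < f x} s) * ?V x \<partial>M) \<partial>lborel)"
  proof (rule nn_integral_mono)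
    fix s :: real
    show "(\<integral>\<^sup>+ x. ennreal (q * s powr (q - 1)) * indicator {s. 0 < s \<and> ennreal s < ?F x} s * v x \<partial>M)
      \<le> (\<integral>\<^sup>+ x. f x * (ennreal (2 * q * s powr (q - 2)) * indicator {s. 0 < s \<and> ennreal (s / 2) < f x} s) * ?V x \<partial>M)"
    proof (cases "0 < s")
      case True
      let ?c = "2 * q * s powr (q - 2)"
      \<comment> \<open>Splits off the factor s/2 that the truncated weak type bound carries on its
        left side.\<close>
      have "q * s powr (q - 1) = ?c * (s / 2)"
        using True by (simp add: powr_diff field_simps power2_eq_square)
      then have c: "ennreal (q * s powr (q - 1)) = ennreal ?c * ennreal (s / 2)"
        using True assms(5) ennreal_mult[of ?c "s / 2"] by simp
      have s: "2 * ennreal (s / 2) = ennreal s"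
        using True by (simp add: numeral_mult_ennreal)
      have "(\<integral>\<^sup>+ x. ennreal (q * s powr (q - 1)) * indicator {s. 0 < s \<and> ennreal s < ?F x} s * v x \<partial>M)
        = (\<integral>\<^sup>+ x. ennreal ?c * (ennreal (s / 2) * (v x * indicator {x. ennreal s < ?F x} x)) \<partial>M)"
        unfolding c using True
        by (intro nn_integral_cong) (auto simp: indicator_def mult_ac)
      also have "\<dots> = ennreal ?c * (ennreal (s / 2) * (\<integral>\<^sup>+ x. v x * indicator {x. ennreal s < ?F x} x \<partial>M))"
        by (subst nn_integral_cmult, measurable, subst nn_integral_cmult, measurable)
      also have "\<dots> \<le> ennreal ?c * (\<integral>\<^sup>+ x. f x * indicator {x. ennreal (s / 2) < f x} x * ?V x \<partial>M)"
        using max_over_weak_type_truncated[OF assms(2-4,6,7), of "ennreal (s / 2)"]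
        by (intro mult_left_mono) (auto simp: s)
      also have "\<dots> = (\<integral>\<^sup>+ x. ennreal ?c * (f x * indicator {x. ennreal (s / 2) < f x} x * ?V x) \<partial>M)"
        by (rule nn_integral_cmult[symmetric]) measurable
      also have "\<dots> = (\<integral>\<^sup>+ x. f x * (ennreal ?c * indicator {s. 0 < s \<and> ennreal (s / 2) < f x} s) * ?V x \<partial>M)"
        using True by (intro nn_integral_cong) (auto simp: indicator_def mult_ac)
      finally show ?thesis .
    qed simp
  qed
  also have "\<dots> = (\<integral>\<^sup>+ x. (\<integral>\<^sup>+ s. f x * (ennreal (2 * q * s powr (q - 2)) * indicator {s. 0 < s \<and> ennreal (s / 2) < f x} s) * ?V x \<partial>lborel) \<partial>M)"
    by (rule Fubini') measurable
  also have "\<dots> = (\<integral>\<^sup>+ x. f x * (\<integral>\<^sup>+ s. ennreal (2 * q * s powr (q - 2)) * indicator {s. 0 < s \<and> ennreal (s / 2) < f x} s \<partial>lborel) * ?V x \<partial>M)"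
    by (intro nn_integral_cong, subst nn_integral_multc, measurable, subst nn_integral_cmult, measurable)
  also have "\<dots> \<le> (\<integral>\<^sup>+ x. ennreal (q * 2 powr q / (q - 1)) * (epowr (f x) q * ?V x) \<partial>M)"
    using epowr_inner_layer[OF assms(5)]
    by (intro nn_integral_mono) (auto simp: mult.assoc[symmetric] intro!: mult_right_mono)
  also have "\<dots> = ennreal (q * 2 powr q / (q - 1)) * (\<integral>\<^sup>+ x. epowr (f x) q * ?V x \<partial>M)"
    by (rule nn_integral_cmult) measurable
  finally show ?thesis .
qed

subsection \<open>Level sets under the growth conditions\<close>

lemma growth_iterate:
  fixes \<phi> :: "real \<Rightarrow> ennreal"
  assumes nabla: "\<And>r. 0 < r \<Longrightarrow> ennreal (2 * k) * \<phi> r \<le> \<phi> (k * r)" and "1 < k" "0 < t"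
  shows "ennreal ((2 * k) ^ i) * \<phi> t \<le> \<phi> (k ^ i * t)"
proof (induction i)
  case (Suc i)
  have "ennreal ((2 * k) ^ Suc i) * \<phi> t = ennreal (2 * k) * (ennreal ((2 * k) ^ i) * \<phi> t)"
    using assms(2) by (simp add: ennreal_mult[symmetric] mult.assoc[symmetric])
  also have "\<dots> \<le> ennreal (2 * k) * \<phi> (k ^ i * t)"
    by (intro mult_left_mono Suc) simp
  also have "\<dots> \<le> \<phi> (k ^ Suc i * t)"
    using nabla[of "k ^ i * t"] assms(2,3) by (simp add: mult_ac)
  finally show ?case .
qed simp

lemma ennreal_mult_le_imp_le_divide:
  assumes "0 < c" "0 \<le> S" "ennreal c * x \<le> ennreal S"
  shows "x \<le> ennreal (S / c)"
proof -
  have "ennreal c * x \<le> ennreal c * ennreal (S / c)"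
    using assms by (simp add: ennreal_mult[symmetric])
  then show ?thesis
    using assms(1) by (subst (asm) ennreal_mult_le_mult_iff) auto
qed

text \<open>The gain (2k)^i exceeds the scaling k^i of the level by 2^i. The surplus makes the tail
  series converge, and a large i brings any S below 1.\<close>

lemma growth_amplify:
  fixes \<phi> :: "real \<Rightarrow> ennreal"
  assumes nabla: "\<And>r. 0 < r \<Longrightarrow> ennreal (2 * k) * \<phi> r \<le> \<phi> (k * r)" and "1 < k"
    and "\<And>t. 0 < t \<Longrightarrow> \<phi> t * m t \<le> ennreal S" "0 \<le> S" "0 < t"
  shows "\<phi> t * m (k ^ i * t) \<le> ennreal (S / (2 * k) ^ i)"
proof (rule ennreal_mult_le_imp_le_divide)
  have "ennreal ((2 * k) ^ i) * (\<phi> t * m (k ^ i * t)) \<le> \<phi> (k ^ i * t) * m (k ^ i * t)"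
    using growth_iterate[of k \<phi> t i] assms by (simp add: mult.assoc[symmetric] mult_right_mono)
  also have "\<dots> \<le> ennreal S"
    using assms by simp
  finally show "ennreal ((2 * k) ^ i) * (\<phi> t * m (k ^ i * t)) \<le> ennreal S" .
qed (use assms in auto)

lemma le_suminf_ennreal: "f i \<le> suminf f" for f :: "nat \<Rightarrow> ennreal"
  using ennreal_suminf_lessD[of f "f i" i] by (meson not_less order.irrefl)

text \<open>For finite y one term is enough, namely the i with k^i t < y \<le> k^(i+1) t; for y =
  top every term is at least t. Integrating the sum yields the distribution function at the levels
  k^i t.\<close>

lemma le_suminf_geometric_levels:
  assumes "1 < k" "0 < t" "ennreal t < y"
  shows "y \<le> (\<Sum>i. ennreal (k ^ Suc i * t) * indicator {y. ennreal (k ^ i * t) < y} y)" (is "_ \<le> suminf ?h")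
proof (cases y)
  case (real r)
  obtain n where "r / t < k ^ n"
    using real_arch_pow[OF assms(1)] by blast
  then have ex: "\<exists>n. r \<le> k ^ n * t"
    using assms(2) by (intro exI[of _ n]) (simp add: field_simps)
  define n where "n = (LEAST n. r \<le> k ^ n * t)"
  have n: "r \<le> k ^ n * t"
    unfolding n_def by (rule LeastI_ex[OF ex])
  have "t < r"
    using assms real by (simp add: ennreal_less_iff)
  then have "n \<noteq> 0" using n by (intro notI) simp
  then obtain i where i: "n = Suc i" by (cases n) auto
  have "k ^ i * t < r"
    using not_less_Least[of i "\<lambda>n. r \<le> k ^ n * t"] i by (simp add: n_def)
  then have "y \<le> ?h i"
    using n real assms i by (auto simp: ennreal_less_iff)
  also have "?h i \<le> suminf ?h" by (rule le_suminf_ennreal)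
  finally show ?thesis .
next
  case top
  have "(\<Sum>i. ennreal t) \<le> suminf ?h"
  proof (intro suminf_le)
    fix i
    have "1 * t \<le> k ^ Suc i * t"
      using assms by (intro mult_right_mono one_le_power) auto
    then show "ennreal t \<le> ?h i" using top by (auto intro!: ennreal_leI)
  qed auto
  moreover have "(\<Sum>i::nat. ennreal t) = top"
  proof (rule ccontr)
    assume "(\<Sum>i::nat. ennreal t) \<noteq> top"
    then have "summable (\<lambda>i::nat. t)"
      using assms(2) by (intro summable_suminf_not_top) auto
    then show False using assms(2) by (simp add: summable_const_iff)
  qed
  ultimately show ?thesis by (simp add: top_unique)
qed

text \<open>Level i contributes at most k^(i+1) t / (2k)^i = k t / 2^i, and these add up to
  2kt.\<close>

lemma nabla_tail_integral:
  fixes \<phi> :: "real \<Rightarrow> ennreal"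
  assumes nabla: "\<And>r. 0 < r \<Longrightarrow> ennreal (2 * k) * \<phi> r \<le> \<phi> (k * r)" and k: "1 < k"
    and level: "\<And>t. 0 < t \<Longrightarrow> \<phi> t * emeasure M {x\<in>space M. ennreal t < F x} \<le> 1"
    and [measurable]: "F \<in> borel_measurable M" and t: "0 < t"
  shows "\<phi> t * (\<integral>\<^sup>+ x. F x * indicator {x. ennreal t < F x} x \<partial>M) \<le> ennreal (2 * k * t)"
proof -
  let ?m = "\<lambda>t. emeasure M {x\<in>space M. ennreal t < F x}"
  have "(\<integral>\<^sup>+ x. F x * indicator {x. ennreal t < F x} x \<partial>M)
     \<le> (\<integral>\<^sup>+ x. (\<Sum>i. ennreal (k ^ Suc i * t) * indicator {x\<in>space M. ennreal (k ^ i * t) < F x} x) \<partial>M)"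
  proof (rule nn_integral_mono)
    fix x assume "x \<in> space M"
    then show "F x * indicator {x. ennreal t < F x} x
        \<le> (\<Sum>i. ennreal (k ^ Suc i * t) * indicator {x\<in>space M. ennreal (k ^ i * t) < F x} x)"
      using le_suminf_geometric_levels[OF k t, of "F x"] by (auto simp: indicator_def cong: if_cong)
  qed
  also have "\<dots> = (\<Sum>i. ennreal (k ^ Suc i * t) * ?m (k ^ i * t))"
    by (subst nn_integral_suminf) (auto simp: nn_integral_cmult_indicator)
  finally have "\<phi> t * (\<integral>\<^sup>+ x. F x * indicator {x. ennreal t < F x} x \<partial>M)
      \<le> \<phi> t * (\<Sum>i. ennreal (k ^ Suc i * t) * ?m (k ^ i * t))"
    by (rule mult_left_mono) simp
  also have "\<dots> = (\<Sum>i. ennreal (k ^ Suc i * t) * (\<phi> t * ?m (k ^ i * t)))"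
    by (subst ennreal_suminf_cmult[symmetric]) (simp add: mult_ac)
  also have "\<dots> \<le> (\<Sum>i. ennreal (k ^ Suc i * t) * ennreal (1 / (2 * k) ^ i))"
    using growth_amplify[of k \<phi> ?m 1 t] nabla k level t
    by (intro suminf_le mult_left_mono) auto
  also have "\<dots> = (\<Sum>i. ennreal (k * t * (1 / 2) ^ i))"
    using k t by (intro suminf_cong) (simp add: ennreal_mult[symmetric] field_simps power_mult_distrib)
  also have "\<dots> = ennreal (2 * k * t)"
    using k t sums_mult[OF geometric_sums[of "1 / 2 :: real"], of "k * t"]
    by (intro suminf_ennreal_eq) (auto simp: mult_ac)
  finally show ?thesis .
qed

text \<open>For y > 0 the term with t / 2^(i+1) < y \<le> t / 2^i is enough, since then (y/t)^a
  \<le> 2^(-ai). The value 0 lies above no level.\<close>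

lemma epowr_le_suminf_dyadic_levels:
  assumes "0 < t" "y \<le> ennreal t" "0 < a"
  shows "epowr (y / ennreal t) a
    \<le> (\<Sum>i. ennreal ((1 / 2 powr a) ^ i) * indicator {y. ennreal (t / 2 ^ Suc i) < y} y)" (is "_ \<le> suminf ?h")
proof (cases "y = 0")
  case False
  then obtain r where r: "y = ennreal r" "0 < r" "r \<le> t"
    using assms by (cases y) (auto simp: top_unique)
  obtain n where "t / r < 2 ^ n"
    using real_arch_pow[of 2] by auto
  then have ex: "\<exists>n. t / 2 ^ n < r"
    using r by (intro exI[of _ n]) (simp add: field_simps)
  define n where "n = (LEAST n. t / 2 ^ n < r)"
  have n: "t / 2 ^ n < r"
    unfolding n_def by (rule LeastI_ex[OF ex])
  have "n \<noteq> 0" using n r by (intro notI) simp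
  then obtain i where i: "n = Suc i" by (cases n) auto
  have "r \<le> t / 2 ^ i"
    using not_less_Least[of i "\<lambda>n. t / 2 ^ n < r"] i by (simp add: n_def)
  then have "r / t \<le> 1 / 2 ^ i"
    using assms(1) by (simp add: field_simps)
  then have "(r / t) powr a \<le> (1 / 2 ^ i) powr a"
    using assms r by (intro powr_mono2) auto
  also have "\<dots> = (1 / 2 powr a) ^ i"
    by (simp add: powr_divide powr_powr powr_power power_divide powr_realpow[symmetric] mult.commute)
  finally have "epowr (y / ennreal t) a \<le> ?h i"
    using n r assms i by (auto simp: ennreal_less_iff divide_ennreal)
  also have "?h i \<le> suminf ?h" by (rule le_suminf_ennreal)
  finally show ?thesis .
qed simp

text \<open>Going down i + 1 halvings from t costs d^(i+1), while the integrand has decayed to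
  2^(-ai). With 2^a \<ge> 2d the terms are at most d / 2^i, hence the bound 2d.\<close>

lemma doubling_head_integral:
  fixes \<phi> :: "real \<Rightarrow> ennreal"
  assumes doubling: "\<And>r. 0 < r \<Longrightarrow> \<phi> (2 * r) \<le> ennreal d * \<phi> r" and d: "1 < d" and a: "0 < a" "2 * d \<le> 2 powr a"
    and level: "\<And>t. 0 < t \<Longrightarrow> \<phi> t * emeasure M {x\<in>space M. ennreal t < F x} \<le> 1"
    and [measurable]: "F \<in> borel_measurable M" and t: "0 < t"
  shows "\<phi> t * (\<integral>\<^sup>+ x. epowr (F x / ennreal t) a * indicator {x. F x \<le> ennreal t} x \<partial>M) \<le> ennreal (2 * d)"
proof -
  let ?m = "\<lambda>t. emeasure M {x\<in>space M. ennreal t < F x}"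
  have iter: "\<phi> t \<le> ennreal (d ^ i) * \<phi> (t / 2 ^ i)" for i
  proof (induction i)
    case (Suc i)
    have "ennreal (d ^ i) * \<phi> (t / 2 ^ i) \<le> ennreal (d ^ i) * (ennreal d * \<phi> (t / 2 ^ Suc i))"
      using doubling[of "t / 2 ^ Suc i"] t by (intro mult_left_mono) auto
    also have "\<dots> = ennreal (d ^ Suc i) * \<phi> (t / 2 ^ Suc i)"
      using d by (simp add: ennreal_mult mult_ac)
    finally show ?case using Suc by (rule order_trans[rotated])
  qed simp
  have "(\<integral>\<^sup>+ x. epowr (F x / ennreal t) a * indicator {x. F x \<le> ennreal t} x \<partial>M)
     \<le> (\<integral>\<^sup>+ x. (\<Sum>i. ennreal ((1 / 2 powr a) ^ i) * indicator {x\<in>space M. ennreal (t / 2 ^ Suc i) < F x} x) \<partial>M)"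
  proof (rule nn_integral_mono)
    fix x assume "x \<in> space M"
    then show "epowr (F x / ennreal t) a * indicator {x. F x \<le> ennreal t} x
        \<le> (\<Sum>i. ennreal ((1 / 2 powr a) ^ i) * indicator {x\<in>space M. ennreal (t / 2 ^ Suc i) < F x} x)"
      using epowr_le_suminf_dyadic_levels[OF t, of "F x" a] a by (auto simp: indicator_def cong: if_cong)
  qed
  also have "\<dots> = (\<Sum>i. ennreal ((1 / 2 powr a) ^ i) * ?m (t / 2 ^ Suc i))"
    by (subst nn_integral_suminf) (auto simp: nn_integral_cmult_indicator)
  finally have "\<phi> t * (\<integral>\<^sup>+ x. epowr (F x / ennreal t) a * indicator {x. F x \<le> ennreal t} x \<partial>M)
      \<le> \<phi> t * (\<Sum>i. ennreal ((1 / 2 powr a) ^ i) * ?m (t / 2 ^ Suc i))"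
    by (rule mult_left_mono) simp
  also have "\<dots> = (\<Sum>i. ennreal ((1 / 2 powr a) ^ i) * (\<phi> t * ?m (t / 2 ^ Suc i)))"
    by (subst ennreal_suminf_cmult[symmetric]) (simp add: mult_ac)
  also have "\<dots> \<le> (\<Sum>i. ennreal (d * (1 / 2) ^ i))"
  proof (intro suminf_le)
    fix i
    have "\<phi> t * ?m (t / 2 ^ Suc i) \<le> ennreal (d ^ Suc i) * (\<phi> (t / 2 ^ Suc i) * ?m (t / 2 ^ Suc i))"
      using iter[of "Suc i"] by (simp add: mult.assoc[symmetric] mult_right_mono del: power_Suc)
    also have "\<dots> \<le> ennreal (d ^ Suc i) * 1"
      using t by (intro mult_left_mono level) auto
    finally have "ennreal ((1 / 2 powr a) ^ i) * (\<phi> t * ?m (t / 2 ^ Suc i)) \<le> ennreal ((1 / 2 powr a) ^ i) * ennreal (d ^ Suc i)"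
      by (intro mult_left_mono) auto
    also have "\<dots> = ennreal (d * (d / 2 powr a) ^ i)"
      using d by (simp add: ennreal_mult[symmetric] power_divide)
    also have "\<dots> \<le> ennreal (d * (1 / 2) ^ i)"
      using d a by (intro ennreal_leI mult_left_mono power_mono) (auto simp: field_simps)
    finally show "ennreal ((1 / 2 powr a) ^ i) * (\<phi> t * ?m (t / 2 ^ Suc i)) \<le> ennreal (d * (1 / 2) ^ i)" .
  qed auto
  also have "\<dots> = ennreal (2 * d)"
    using d sums_mult[OF geometric_sums[of "1 / 2 :: real"], of d]
    by (intro suminf_ennreal_eq) (auto simp: mult_ac)
  finally show ?thesis .
qed

subsection \<open>Level sets of maximal functions\<close>

lemma average_eq_0_of_degenerate:
  assumes "emeasure M Q = 0 \<or> emeasure M Q = top" "Q \<in> sets M" "f \<in> borel_measurable M"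
  shows "average M f Q = 0"
proof (rule ccontr)
  assume "average M f Q \<noteq> 0"
  then have "0 < average M f Q" by (simp add: zero_less_iff_neq_zero)
  from less_averageD[OF this assms(2,3)] assms(1) show False by auto
qed

lemma max_over_1_le: "max_over D M (\<lambda>_. 1) x \<le> 1" if "D \<subseteq> sets M"
proof -
  have "average M (\<lambda>_. 1) Q \<le> 1" if "Q \<in> D" for Q
    using that \<open>D \<subseteq> sets M\<close> by (cases "emeasure M Q = 0"; cases "emeasure M Q = top")
      (auto simp: average_def divide_eq_1_ennreal[THEN iffD2] less_top[symmetric])
  then show ?thesis by (simp add: max_over_le_iff)
qed

text \<open>Both averages have the same numerator, and the hypothesis on Q says that the new
  denominator is at most s times the old one. The lower bound on u keeps the new measure of Q
  positive. The factorisation of f is asked for almost everywhere because a quotient by u cannot be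
  undone where u is infinite.\<close>

lemma average_le_density:
  assumes [measurable]: "Q \<in> sets M" "f \<in> borel_measurable M" "u \<in> borel_measurable M" "h \<in> borel_measurable M"
    and f: "AE x in M. f x = h x * u x"
    and u: "\<And>x. ennreal t \<le> u x" "0 < t"
    and Q: "(\<integral>\<^sup>+ x\<in>Q. u x \<partial>M) \<le> ennreal s * emeasure M Q" 
  shows "average M f Q \<le> ennreal s * average (density M u) h Q"
proof (cases "emeasure M Q = 0 \<or> emeasure M Q = top")
  case True
  then show ?thesis by (simp add: average_eq_0_of_degenerate)
next
  case False
  then obtain a where a: "emeasure M Q = ennreal a" "0 < a"
    by (cases "emeasure M Q") (auto simp: less_le)
  have \<mu>: "emeasure (density M u) Q = (\<integral>\<^sup>+ x\<in>Q. u x \<partial>M)"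
    by (simp add: emeasure_density)
  have "ennreal t * emeasure M Q = (\<integral>\<^sup>+ x\<in>Q. ennreal t \<partial>M)"
    by (simp add: nn_integral_cmult_indicator)
  also have "\<dots> \<le> emeasure (density M u) Q"
    unfolding \<mu> using u by (intro nn_integral_mono mult_right_mono) auto
  finally have lo: "ennreal (t * a) \<le> emeasure (density M u) Q"
    using a u by (simp add: ennreal_mult)
  have "emeasure (density M u) Q \<le> ennreal s * ennreal a"
    using Q by (simp add: \<mu> a)
  also have "\<dots> = ennreal (s * a)"
    using a by (simp add: ennreal_mult'')
  finally have hi: "emeasure (density M u) Q \<le> ennreal (s * a)" .
  then obtain b where b: "emeasure (density M u) Q = ennreal b" "0 \<le> b"
    by (cases "emeasure (density M u) Q") (auto simp: top_unique)
  have "0 < t * a" using a u by simp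
  then have b0: "0 < b" "b \<le> s * a"
    using lo hi b by (auto simp: ennreal_le_iff2)
  then have "0 < s * a" by linarith
  then have s: "0 < s" using a by (simp add: zero_less_mult_iff)
  have "(\<integral>\<^sup>+ x\<in>Q. f x \<partial>M) = (\<integral>\<^sup>+ x. u x * (h x * indicator Q x) \<partial>M)"
    using f by (intro nn_integral_cong_AE) (auto simp: mult_ac)
  also have "\<dots> = (\<integral>\<^sup>+ x\<in>Q. h x \<partial>density M u)"
    by (subst nn_integral_density) auto
  finally have I: "(\<integral>\<^sup>+ x\<in>Q. f x \<partial>M) = (\<integral>\<^sup>+ x\<in>Q. h x \<partial>density M u)" .
  have "inverse (ennreal a) \<le> ennreal s * inverse (ennreal b)"
    using a b0 s by (simp add: inverse_ennreal ennreal_mult[symmetric] field_simps)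
  then have "(\<integral>\<^sup>+ x\<in>Q. h x \<partial>density M u) * inverse (ennreal a) \<le> (\<integral>\<^sup>+ x\<in>Q. h x \<partial>density M u) * (ennreal s * inverse (ennreal b))"
    by (intro mult_left_mono) auto
  then show ?thesis
    unfolding average_def I by (simp add: a b divide_ennreal_def mult_ac)
qed

text \<open>The integral of F over a cell around x is at most 2t times its measure, and the summand
  t raises this to 3t.\<close>

lemma max_over_le_density:
  assumes D: "D \<subseteq> sets M"
    and [measurable]: "g \<in> borel_measurable M" "F \<in> borel_measurable M" "h \<in> borel_measurable M"
    and g: "AE x in M. g x = h x * (F x + ennreal t)" and t: "0 < t"
    and x: "max_over D M F x \<le> ennreal (2 * t)"
  shows "max_over D M g x \<le> ennreal (3 * t) * max_over D (density M (\<lambda>x. F x + ennreal t)) h x"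
proof -
  have "average M g Q \<le> ennreal (3 * t) * max_over D (density M (\<lambda>x. F x + ennreal t)) h x" if Q: "Q \<in> D" "x \<in> Q" for Q
  proof (cases "emeasure M Q = 0 \<or> emeasure M Q = top")
    case True
    then show ?thesis using Q D by (auto simp: average_eq_0_of_degenerate)
  next
    case False
    have [measurable]: "Q \<in> sets M" using D Q by auto
    have "average M F Q \<le> ennreal (2 * t)"
      using x Q by (auto simp: max_over_le_iff)
    then have "average M F Q * emeasure M Q \<le> ennreal (2 * t) * emeasure M Q"
      by (rule mult_right_mono) simp
    moreover have "average M F Q * emeasure M Q = (\<integral>\<^sup>+ x\<in>Q. F x \<partial>M)"
      using False by (simp add: average_def ennreal_divide_times less_top[symmetric])
    moreover have "(\<integral>\<^sup>+ x\<in>Q. F x + ennreal t \<partial>M) = (\<integral>\<^sup>+ x\<in>Q. F x \<partial>M) + ennreal t * emeasure M Q"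
      by (simp add: distrib_right nn_integral_add nn_integral_cmult_indicator)
    ultimately have "(\<integral>\<^sup>+ x\<in>Q. F x + ennreal t \<partial>M) \<le> ennreal (2 * t) * emeasure M Q + ennreal t * emeasure M Q"
      by (simp add: add_right_mono)
    also have "\<dots> = ennreal (3 * t) * emeasure M Q"
      using t by (simp add: distrib_right[symmetric] ennreal_plus[symmetric] del: ennreal_plus)
    finally have "average M g Q \<le> ennreal (3 * t) * average (density M (\<lambda>x. F x + ennreal t)) h Q"
      using g t by (intro average_le_density[where t = t]) auto
    also have "\<dots> \<le> ennreal (3 * t) * max_over D (density M (\<lambda>x. F x + ennreal t)) h x"
      using Q by (intro mult_left_mono average_le_max_over) auto
    finally show ?thesis .
  qed
  then show ?thesis by (simp add: max_over_le_iff)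
qed

text \<open>Outside the set where the maximal function of $F$ exceeds $2t$, averages with respect to the given
  measure are at most $3t$ times averages of $g_j/(F+t)$ with respect to the density $F + t$. The strong
  type bound for the latter measure is dualized against the indicator of $E$; since $F/(F+t) \le 1$,
  raising it to the large power $qp$ costs nothing where $F > t$.\<close>

lemma vector_max_over_level_bound:
  fixes g :: "nat \<Rightarrow> 'a \<Rightarrow> ennreal" and q p t c :: real
  defines "F \<equiv> \<lambda>x. epowr (\<Sum>j. epowr (g j x) q) (1 / q)"
    and "C \<equiv> \<lambda>r::real. r * 2 powr r / (r - 1)"
  assumes M: "sigma_finite_measure M" and D: "countable D" "D \<subseteq> sets M" "laminar D"
    and q: "1 < q" and p: "1 < p" and t: "0 < t"
    and c: "c = 3 * (C q * (2 * C (p / (p - 1)) + 1)) powr (1 / q)"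
    and g [measurable]: "\<And>j. g j \<in> borel_measurable M"
    and F: "AE x in M. F x \<noteq> top"
    and E [measurable]: "E \<in> sets M" and E_fin: "emeasure M E < top"
    and E_le: "\<And>x. x \<in> E \<Longrightarrow> F x \<le> ennreal t"
    and E_max: "\<And>x. x \<in> E \<Longrightarrow> max_over D M F x \<le> ennreal (2 * t)"
    and E_large: "\<And>x. x \<in> E \<Longrightarrow> ennreal ((c * t) powr q) \<le> (\<Sum>j. epowr (max_over D M (g j) x) q)"
  shows "ennreal t * emeasure M E \<le> 2 * (\<integral>\<^sup>+ x. F x * indicator {x. ennreal t < F x} x \<partial>M)
    + ennreal (2 * t) * (\<integral>\<^sup>+ x. epowr (F x / ennreal t) (q * p) * indicator {x. F x \<le> ennreal t} x \<partial>M)" (is "_ \<le> ?Y")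
proof -
  interpret M: sigma_finite_measure M by fact
  define p' where "p' = p / (p - 1)"
  have p': "1 < p'" using p by (simp add: p'_def)
  have C: "0 < C r" if "1 < r" for r using that by (simp add: C_def)
  define u where "u x = F x + ennreal t" for x
  define \<mu> where "\<mu> = density M u"
  define h where "h j x = g j x / u x" for j x
  define V where "V = max_over D \<mu> (indicator E)"
  have [measurable]: "F \<in> borel_measurable M" "u \<in> borel_measurable M" "h j \<in> borel_measurable M" for j
    unfolding h_def u_def F_def by measurable
  have sets_\<mu> [simp]: "sets \<mu> = sets M" by (simp add: \<mu>_def)
  have meas_\<mu>: "borel_measurable \<mu> = borel_measurable M"
    by (auto intro!: measurable_cong_sets)
  have D\<mu>: "D \<subseteq> sets \<mu>" using D by simp
  note [measurable] = borel_measurable_max_over[OF D(1,2)] borel_measurable_max_over[OF D(1) D\<mu>, unfolded meas_\<mu>]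
  have V [measurable]: "V \<in> borel_measurable M" by (simp add: V_def)
  \<comment> \<open>A density that is finite almost everywhere preserves sigma-finiteness, which
    Fubini in the strong type bound requires.\<close>
  have "AE x in M. u x \<noteq> \<infinity>" using F by eventually_elim (simp add: u_def)
  then have \<mu>: "sigma_finite_measure \<mu>"
    unfolding \<mu>_def by (subst M.sigma_finite_iff_density_finite) auto
  have int_\<mu>: "(\<integral>\<^sup>+ x. w x \<partial>\<mu>) = (\<integral>\<^sup>+ x. u x * w x \<partial>M)" if "w \<in> borel_measurable M" for w
    unfolding \<mu>_def using that by (simp add: nn_integral_density)
  have Fq: "epowr (F x) q = (\<Sum>j. epowr (g j x) q)" for x
    using q by (simp add: F_def epowr_epowr)
  have "AE x in M. g j x = h j x * u x" for j
    using F
  proof eventually_elim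
    case (elim x)
    have "0 < u x" "u x < top"
      using elim t by (auto simp: u_def less_top add_pos_nonneg zero_less_iff_neq_zero)
    then show ?case by (simp add: h_def ennreal_divide_times)
  qed
  then have gh: "max_over D M (g j) x \<le> ennreal (3 * t) * max_over D \<mu> (h j) x" if "x \<in> E" for x j
    unfolding \<mu>_def u_def using D t E_max[OF that] by (intro max_over_le_density) (auto simp: u_def)
  have hF: "(\<Sum>j. epowr (h j x) q) = epowr (F x / u x) q" for x
    by (simp add: h_def divide_ennreal_def epowr_mult Fq)
  define K where "K = (3 * t) powr q"
  define e where "e = emeasure M E"
  have \<mu>E: "emeasure \<mu> E \<le> ennreal (2 * t) * e"
  proof -
    have "emeasure \<mu> E = (\<integral>\<^sup>+ x\<in>E. u x \<partial>M)"
      by (simp add: \<mu>_def emeasure_density)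
    also have "\<dots> \<le> (\<integral>\<^sup>+ x\<in>E. ennreal (2 * t) \<partial>M)"
    proof (intro nn_integral_mono)
      fix x
      have "F x + ennreal t \<le> ennreal t + ennreal t" if "x \<in> E"
        using E_le[OF that] by (rule add_right_mono)
      then show "u x * indicator E x \<le> ennreal (2 * t) * indicator E x"
        using t by (auto simp: u_def indicator_def ennreal_plus[symmetric] simp del: ennreal_plus)
    qed
    finally show ?thesis by (simp add: nn_integral_cmult_indicator e_def)
  qed
  \<comment> \<open>The strong type bound with weight 1 for the indicator of E. Its right side is a
    multiple of t * e and is the term absorbed at the end.\<close>
  have V1: "(\<integral>\<^sup>+ x. epowr (V x) p' \<partial>\<mu>) \<le> ennreal (C p') * (ennreal (2 * t) * e)"
  proof -
    have "(\<integral>\<^sup>+ x. epowr (V x) p' * 1 \<partial>\<mu>)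
      \<le> ennreal (C p') * (\<integral>\<^sup>+ x. epowr (indicator E x) p' * max_over D \<mu> (\<lambda>_. 1) x \<partial>\<mu>)"
      unfolding V_def C_def using p' D by (intro max_over_strong_type \<mu>) (auto simp: meas_\<mu>)
    also have "\<dots> \<le> ennreal (C p') * (\<integral>\<^sup>+ x. indicator E x \<partial>\<mu>)"
      using max_over_1_le[OF D\<mu>]
      by (intro mult_left_mono nn_integral_mono) (auto simp: indicator_def)
    also have "\<dots> \<le> ennreal (C p') * (ennreal (2 * t) * e)"
      using \<mu>E by (intro mult_left_mono) auto
    finally show ?thesis by simp
  qed
  \<comment> \<open>Where F \<le> t, u is at most 2t and F / u at most F / t; where F > t, u is at
    most 2F and F / u at most 1. The two regimes give the two integrals of the claim.\<close>
  have U1: "(\<integral>\<^sup>+ x. epowr (F x / u x) (q * p) \<partial>\<mu>) \<le> ?Y"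
  proof -
    have "u x * epowr (F x / u x) (q * p) \<le> 2 * (F x * indicator {x. ennreal t < F x} x)
        + ennreal (2 * t) * (epowr (F x / ennreal t) (q * p) * indicator {x. F x \<le> ennreal t} x)" for x
    proof (cases "F x \<le> ennreal t")
      case True
      have "u x \<le> ennreal t + ennreal t"
        unfolding u_def using True by (rule add_right_mono)
      then have "u x \<le> ennreal (2 * t)"
        using t by (simp add: ennreal_plus[symmetric] del: ennreal_plus)
      moreover have "F x / u x \<le> F x / ennreal t"
      proof (rule divide_le_posI_ennreal)
        have "F x = ennreal t * (F x / ennreal t)"
          using t by (simp add: ennreal_times_divide mult.commute[of "ennreal t"] mult_divide_eq_ennreal)
        also have "\<dots> \<le> u x * (F x / ennreal t)"
          by (intro mult_right_mono) (auto simp: u_def)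
        finally show "F x \<le> u x * (F x / ennreal t)" .
      qed (use t in \<open>simp add: u_def add_nonneg_pos\<close>)
      then have "epowr (F x / u x) (q * p) \<le> epowr (F x / ennreal t) (q * p)"
        using q p by (intro epowr_mono) auto
      ultimately show ?thesis using True by (simp add: mult_mono)
    next
      case False
      then have "u x \<le> F x + F x"
        unfolding u_def by (intro add_left_mono) auto
      moreover have "F x / u x \<le> 1"
        using t by (intro divide_le_posI_ennreal) (auto simp: u_def add_nonneg_pos)
      then have "epowr (F x / u x) (q * p) \<le> 1"
        using epowr_mono[of "F x / u x" 1 "q * p"] q p by simp
      ultimately have "u x * epowr (F x / u x) (q * p) \<le> (F x + F x) * 1"
        by (rule mult_mono) simp_all
      also have "(F x + F x) * 1 = 2 * F x"
        by (simp only: mult_2 mult_1_right)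
      finally show ?thesis using False by simp
    qed
    then have "(\<integral>\<^sup>+ x. epowr (F x / u x) (q * p) \<partial>\<mu>) \<le> (\<integral>\<^sup>+ x. 2 * (F x * indicator {x. ennreal t < F x} x)
        + ennreal (2 * t) * (epowr (F x / ennreal t) (q * p) * indicator {x. F x \<le> ennreal t} x) \<partial>M)"
      by (subst int_\<mu>) (auto intro!: nn_integral_mono)
    also have "\<dots> = ?Y"
      by (simp add: nn_integral_add nn_integral_cmult)
    finally show ?thesis .
  qed
  have "ennreal t * (ennreal ((c * t) powr q) * e) = (\<integral>\<^sup>+ x. ennreal t * (ennreal ((c * t) powr q) * indicator E x) \<partial>M)"
    by (simp add: nn_integral_cmult nn_integral_cmult_indicator e_def)
  \<comment> \<open>The factor t is traded for u, which turns the integral over M into one over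
    \<mu>; each maximal function costs 3t, hence K.\<close>
  also have "\<dots> \<le> (\<integral>\<^sup>+ x. u x * (ennreal K * (\<Sum>j. epowr (max_over D \<mu> (h j) x) q * indicator E x)) \<partial>M)"
  proof (rule nn_integral_mono, rule mult_mono)
    fix x
    show "ennreal t \<le> u x" by (simp add: u_def)
    show "ennreal ((c * t) powr q) * indicator E x \<le> ennreal K * (\<Sum>j. epowr (max_over D \<mu> (h j) x) q * indicator E x)"
    proof (cases "x \<in> E")
      case True
      have "ennreal ((c * t) powr q) \<le> (\<Sum>j. epowr (max_over D M (g j) x) q)"
        by (rule E_large[OF True])
      also have "\<dots> \<le> (\<Sum>j. epowr (ennreal (3 * t) * max_over D \<mu> (h j) x) q)"
        using gh[OF True] q by (intro suminf_le epowr_mono) auto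
      also have "\<dots> = ennreal K * (\<Sum>j. epowr (max_over D \<mu> (h j) x) q)"
        using t by (simp add: epowr_mult K_def)
      finally show ?thesis using True by simp
    qed simp
  qed auto
  also have "\<dots> = (\<integral>\<^sup>+ x. ennreal K * (\<Sum>j. epowr (max_over D \<mu> (h j) x) q * indicator E x) \<partial>\<mu>)"
    by (rule int_\<mu>[symmetric]) measurable
  also have "\<dots> = ennreal K * (\<Sum>j. \<integral>\<^sup>+ x. epowr (max_over D \<mu> (h j) x) q * indicator E x \<partial>\<mu>)"
    by (subst nn_integral_cmult, simp add: meas_\<mu>, subst nn_integral_suminf) (simp_all add: meas_\<mu>)
  also have "\<dots> \<le> ennreal K * (\<Sum>j. ennreal (C q) * (\<integral>\<^sup>+ x. epowr (h j x) q * V x \<partial>\<mu>))"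
    unfolding V_def C_def using q D
    by (intro mult_left_mono suminf_le max_over_strong_type \<mu>) (auto simp: meas_\<mu>)
  also have "\<dots> = ennreal K * (ennreal (C q) * (\<integral>\<^sup>+ x. (\<Sum>j. epowr (h j x) q * V x) \<partial>\<mu>))"
    by (subst nn_integral_suminf) (simp_all add: meas_\<mu>)
  also have "\<dots> = ennreal K * (ennreal (C q) * (\<integral>\<^sup>+ x. epowr (F x / u x) q * V x \<partial>\<mu>))"
    by (simp add: hF)
  \<comment> \<open>Young's inequality separates V from the power of F / u and raises the exponent q
    to q * p.\<close>
  also have "\<dots> \<le> ennreal K * (ennreal (C q) * (\<integral>\<^sup>+ x. epowr (F x / u x) (q * p) + epowr (V x) p' \<partial>\<mu>))"
    using mult_le_epowr_add[OF p, of "epowr (F x / u x) q" "V x" for x]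
    by (intro mult_left_mono nn_integral_mono) (auto simp: epowr_epowr p'_def)
  also have "\<dots> = ennreal K * (ennreal (C q) * ((\<integral>\<^sup>+ x. epowr (F x / u x) (q * p) \<partial>\<mu>) + (\<integral>\<^sup>+ x. epowr (V x) p' \<partial>\<mu>)))"
    by (subst nn_integral_add) (simp_all add: meas_\<mu>)
  also have "\<dots> \<le> ennreal K * (ennreal (C q) * (?Y + ennreal (C p') * (ennreal (2 * t) * e)))"
    by (intro mult_left_mono add_mono U1 V1) auto
  finally have main: "ennreal t * (ennreal ((c * t) powr q) * e) \<le> ennreal K * (ennreal (C q) * (?Y + ennreal (C p') * (ennreal (2 * t) * e)))" .
  \<comment> \<open>c is chosen so that the term with the measure of E on the right can be absorbed.\<close>
  have ct: "(c * t) powr q = K * C q * (2 * C p' + 1)"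
    unfolding c p'_def[symmetric] K_def using q t C[OF q] C[OF p']
    by (simp add: powr_mult powr_powr)
  show ?thesis
  proof (cases "?Y = top")
    case False
    then obtain Y where Y: "?Y = ennreal Y" "0 \<le> Y" by (cases ?Y) auto
    obtain e' where e': "e = ennreal e'" "0 \<le> e'" using E_fin by (cases e) (auto simp: e_def)
    have pos: "0 < K" "0 < C q" "0 < C p'" using t q p' C by (auto simp: K_def)
    have "ennreal (t * (K * C q * (2 * C p' + 1) * e')) \<le> ennreal (K * (C q * (Y + C p' * (2 * t * e'))))"
      using main pos t e' Y unfolding ct Y by (simp add: ennreal_mult[symmetric] ennreal_plus[symmetric] del: ennreal_plus)
    then have "t * (K * C q * (2 * C p' + 1) * e') \<le> K * (C q * (Y + C p' * (2 * t * e')))"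
      using pos t e' Y by (subst (asm) ennreal_le_iff) auto
    then have "(K * C q) * (t * ((2 * C p' + 1) * e')) \<le> (K * C q) * (Y + C p' * (2 * t * e'))"
      by (simp add: mult_ac)
    then have "t * ((2 * C p' + 1) * e') \<le> Y + C p' * (2 * t * e')"
      using pos by (subst (asm) mult_le_cancel_left_pos) auto
    then have "t * e' \<le> Y" by (simp add: algebra_simps)
    then show ?thesis unfolding Y using e' t Y
      by (simp add: e_def[symmetric] ennreal_mult[symmetric])
  next
    case True
    show ?thesis unfolding True by simp
  qed
qed

text \<open>The truncated weak type bound with v = 1, whose maximal function is at most 1, leaves
  only the tail integral of F above t; its bound 2kt is then divided by t.\<close>

lemma max_over_level_bound:
  fixes \<phi> :: "real \<Rightarrow> ennreal"
  assumes nabla: "\<And>r. 0 < r \<Longrightarrow> ennreal (2 * k) * \<phi> r \<le> \<phi> (k * r)" and k: "1 < k"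
    and D: "countable D" "D \<subseteq> sets M" "laminar D"
    and F [measurable]: "F \<in> borel_measurable M"
    and level: "\<And>t. 0 < t \<Longrightarrow> \<phi> t * emeasure M {x\<in>space M. ennreal t < F x} \<le> 1"
    and t: "0 < t"
  shows "\<phi> t * emeasure M {x\<in>space M. ennreal (2 * t) < max_over D M F x} \<le> ennreal (2 * k)"
proof -
  note [measurable] = borel_measurable_max_over[OF D(1,2)]
  let ?B = "{x\<in>space M. ennreal (2 * t) < max_over D M F x}"
  have t2: "2 * ennreal t = ennreal (2 * t)"
    using t by (simp add: numeral_mult_ennreal)
  have "emeasure M ?B = (\<integral>\<^sup>+ x. indicator ?B x \<partial>M)" by simp
  also have "\<dots> = (\<integral>\<^sup>+ x. 1 * indicator {x. 2 * ennreal t < max_over D M F x} x \<partial>M)"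
    unfolding t2 by (intro nn_integral_cong) (auto simp: indicator_def)
  finally have "ennreal t * emeasure M ?B \<le> (\<integral>\<^sup>+ x. F x * indicator {x. ennreal t < F x} x * max_over D M (\<lambda>_. 1) x \<partial>M)"
    using max_over_weak_type_truncated[OF D F, of "\<lambda>_. 1" "ennreal t"] by simp
  also have "\<dots> \<le> (\<integral>\<^sup>+ x. F x * indicator {x. ennreal t < F x} x * 1 \<partial>M)"
    by (intro nn_integral_mono mult_left_mono max_over_1_le D) simp
  finally have "\<phi> t * (ennreal t * emeasure M ?B) \<le> \<phi> t * (\<integral>\<^sup>+ x. F x * indicator {x. ennreal t < F x} x \<partial>M)"
    by (intro mult_left_mono) auto
  also have "\<dots> \<le> ennreal (2 * k * t)"
    by (rule nabla_tail_integral[OF nabla k level F t])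
  finally have "ennreal t * (\<phi> t * emeasure M ?B) \<le> ennreal (2 * k * t)"
    by (simp add: mult_ac)
  from ennreal_mult_le_imp_le_divide[OF t _ this] show ?thesis
    using t k by simp
qed

text \<open>The points with F > t or with maximal function of F above 2t cost 1 and 2k. On the rest
  the preceding level bound applies, and the tail and head integrals give 2 * 2k + 2 * 2d.\<close>

lemma vector_max_over_weak_bound:
  fixes g :: "nat \<Rightarrow> 'a \<Rightarrow> ennreal" and \<phi> :: "real \<Rightarrow> ennreal" and q p t c :: real
  defines "F \<equiv> \<lambda>x. epowr (\<Sum>j. epowr (g j x) q) (1 / q)"
    and "C \<equiv> \<lambda>r::real. r * 2 powr r / (r - 1)"
  assumes nabla: "\<And>r. 0 < r \<Longrightarrow> ennreal (2 * k) * \<phi> r \<le> \<phi> (k * r)" and k: "1 < k"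
    and doubling: "\<And>r. 0 < r \<Longrightarrow> \<phi> (2 * r) \<le> ennreal d * \<phi> r" and d: "1 < d"
    and M: "sigma_finite_measure M" and D: "countable D" "D \<subseteq> sets M" "laminar D"
    and q: "1 < q" and p: "1 < p" "2 * d \<le> 2 powr (q * p)"
    and c: "c = 3 * (C q * (2 * C (p / (p - 1)) + 1)) powr (1 / q)"
    and g [measurable]: "\<And>j. g j \<in> borel_measurable M"
    and level: "\<And>t. 0 < t \<Longrightarrow> \<phi> t * emeasure M {x\<in>space M. ennreal t < F x} \<le> 1"
    and t: "0 < t"
  shows "\<phi> t * emeasure M {x\<in>space M. ennreal ((c * t) powr q) < (\<Sum>j. epowr (max_over D M (g j) x) q)}
    \<le> ennreal (6 * k + 4 * d + 1)"
proof (cases "\<phi> t = 0")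
  case False
  interpret sigma_finite_measure M by fact
  note [measurable] = borel_measurable_max_over[OF D(1,2)]
  have F [measurable]: "F \<in> borel_measurable M" unfolding F_def by measurable
  define I J where "I = (\<integral>\<^sup>+ x. F x * indicator {x. ennreal t < F x} x \<partial>M)"
    and "J = (\<integral>\<^sup>+ x. epowr (F x / ennreal t) (q * p) * indicator {x. F x \<le> ennreal t} x \<partial>M)"
  have I: "\<phi> t * I \<le> ennreal (2 * k * t)"
    unfolding I_def by (rule nabla_tail_integral[OF nabla k level F t])
  have J: "\<phi> t * J \<le> ennreal (2 * d)"
    unfolding J_def using q p by (intro doubling_head_integral doubling level F t d) auto
  \<comment> \<open>A nonzero \<phi> t forces the tail integral to be finite, hence F to be finite
    almost everywhere.\<close>
  have "I \<noteq> \<infinity>"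
    using I False by (auto simp: ennreal_mult_top top_unique)
  then have "AE x in M. F x * indicator {x. ennreal t < F x} x \<noteq> \<infinity>"
    unfolding I_def by (intro nn_integral_PInf_AE) auto
  then have fin: "AE x in M. F x \<noteq> top"
    by eventually_elim (auto simp: indicator_def)
  define W where "W = {x\<in>space M. ennreal ((c * t) powr q) < (\<Sum>j. epowr (max_over D M (g j) x) q)}"
  define B where "B = {x\<in>space M. ennreal (2 * t) < max_over D M F x}"
  define T where "T = {x\<in>space M. ennreal t < F x}"
  have [measurable]: "W \<in> sets M" "B \<in> sets M" "T \<in> sets M"
    unfolding W_def B_def T_def by measurable
  \<comment> \<open>The level bound subtracts a multiple of the measure of its set, so it is applied
    to pieces of finite measure.\<close>
  obtain A where A: "range A \<subseteq> sets M" "(\<Union>i. A i) = space M" "\<And>i. emeasure M (A i) \<noteq> \<infinity>" "incseq A"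
    using sigma_finite_incseq by metis
  then have [measurable]: "A i \<in> sets M" for i :: nat by auto
  have piece: "\<phi> t * emeasure M ((W - B - T) \<inter> A i) \<le> ennreal (4 * k + 4 * d)" for i
  proof -
    let ?E = "(W - B - T) \<inter> A i"
    have "emeasure M ?E \<le> emeasure M (A i)" by (intro emeasure_mono) auto
    then have "emeasure M ?E < top"
      using A(3)[of i] by (auto simp: less_top[symmetric] top_unique)
    then have "ennreal t * emeasure M ?E \<le> 2 * I + ennreal (2 * t) * J"
      unfolding I_def J_def F_def
      using M D q p t c g fin unfolding F_def C_def
      by (intro vector_max_over_level_bound[where D = D and c = c])
        (auto simp: W_def B_def T_def F_def not_less)
    then have "\<phi> t * (ennreal t * emeasure M ?E) \<le> \<phi> t * (2 * I + ennreal (2 * t) * J)"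
      by (intro mult_left_mono) auto
    also have "\<dots> = 2 * (\<phi> t * I) + ennreal (2 * t) * (\<phi> t * J)"
      by (simp add: distrib_left mult_ac)
    also have "\<dots> \<le> 2 * ennreal (2 * k * t) + ennreal (2 * t) * ennreal (2 * d)"
      by (intro add_mono mult_left_mono I J) auto
    also have "\<dots> = ennreal ((4 * k + 4 * d) * t)"
      using t k d by (simp add: numeral_mult_ennreal ennreal_mult[symmetric] ennreal_plus[symmetric] algebra_simps del: ennreal_plus)
    finally have "ennreal t * (\<phi> t * emeasure M ?E) \<le> ennreal ((4 * k + 4 * d) * t)"
      by (simp add: mult_ac)
    from ennreal_mult_le_imp_le_divide[OF t _ this] show ?thesis
      using t k d by simp
  qed
  have "(SUP i. emeasure M ((W - B - T) \<inter> A i)) = emeasure M (\<Union>i. (W - B - T) \<inter> A i)"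
    using A(4) by (intro SUP_emeasure_incseq) (auto simp: incseq_def)
  also have "(\<Union>i. (W - B - T) \<inter> A i) = W - B - T"
    using A(2) sets.sets_into_space[of W M] by auto
  finally have "\<phi> t * emeasure M (W - B - T) = (SUP i. \<phi> t * emeasure M ((W - B - T) \<inter> A i))"
    by (metis SUP_mult_left_ennreal)
  also have "\<dots> \<le> ennreal (4 * k + 4 * d)"
    by (intro SUP_least piece)
  finally have rest: "\<phi> t * emeasure M (W - B - T) \<le> ennreal (4 * k + 4 * d)" .
  have "emeasure M W \<le> emeasure M ((W - B - T) \<union> (B \<union> T))"
    by (intro emeasure_mono) auto
  also have "\<dots> \<le> emeasure M (W - B - T) + emeasure M (B \<union> T)"
    by (intro emeasure_subadditive) auto
  also have "\<dots> \<le> emeasure M (W - B - T) + (emeasure M B + emeasure M T)"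
    by (intro add_left_mono emeasure_subadditive) auto
  finally have "\<phi> t * emeasure M W \<le> \<phi> t * emeasure M (W - B - T) + (\<phi> t * emeasure M B + \<phi> t * emeasure M T)"
    by (simp add: distrib_left[symmetric] mult_left_mono)
  also have "\<dots> \<le> ennreal (4 * k + 4 * d) + (ennreal (2 * k) + 1)"
    using level[OF t] max_over_level_bound[OF nabla k D F level t]
    by (intro add_mono rest) (auto simp: B_def T_def)
  also have "\<dots> = ennreal (6 * k + 4 * d + 1)"
    using k d by (simp add: ennreal_plus[symmetric] ennreal_1[symmetric] del: ennreal_plus ennreal_1)
  finally show ?thesis by (simp add: W_def)
qed simp

subsection \<open>Triadic grids\<close>

text \<open>Side lengths $3^k$ are used because a shift by half a side length is then compatible with nesting
  across all scales ($3 \cdot \frac12 - \frac12$ is an integer). In each coordinate the endpoints of the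
  shifted and of the unshifted intervals at scale $3^k$ are $3^k/2$ apart, so an interval shorter than
  that lies in a single interval of one of the two systems.\<close>

definition half_shift :: "'n set \<Rightarrow> 'n \<Rightarrow> real" where
  "half_shift A i = (if i \<in> A then 1 / 2 else 0)"

text \<open>Floors make the cells half-open, so each scale partitions the space, and they turn
  nesting into integer division. A collects the shifted coordinates.\<close>

definition triadic_cell :: "'n set \<Rightarrow> int \<Rightarrow> ('n \<Rightarrow> int) \<Rightarrow> (real ^ 'n) set" where
  "triadic_cell A k m = {x. \<forall>i. \<lfloor>x $ i / 3 powr of_int k - half_shift A i\<rfloor> = m i}"

definition triadic_grid :: "'n set \<Rightarrow> (real ^ 'n) set set" where
  "triadic_grid A = (\<Union>k. range (triadic_cell A k))"

lemma countable_triadic_grid: "countable (triadic_grid (A :: 'n::finite set))"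
  unfolding triadic_grid_def by (intro countable_UN countable_image) auto

lemma triadic_cell_measurable [measurable]: "triadic_cell A k m \<in> sets borel"
proof -
  have "triadic_cell A k m = (\<Inter>i. {x. \<lfloor>x $ i / 3 powr of_int k - half_shift A i\<rfloor> = m i})"
    by (auto simp: triadic_cell_def)
  also have "\<dots> \<in> sets borel"
  proof (intro sets.finite_INT)
    fix i
    have [measurable]: "(\<lambda>x :: real ^ 'a. x $ i) \<in> borel_measurable borel"
      by (intro borel_measurable_continuous_onI continuous_intros)
    have "{x \<in> space borel. \<lfloor>(x :: real ^ 'a) $ i / 3 powr of_int k - half_shift A i\<rfloor> = m i} \<in> sets borel"
      by measurable
    then show "{x. \<lfloor>(x :: real ^ 'a) $ i / 3 powr of_int k - half_shift A i\<rfloor> = m i} \<in> sets borel"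
      by simp
  qed auto
  finally show ?thesis .
qed

lemma triadic_grid_sets: "triadic_grid A \<subseteq> sets lebesgue"
  unfolding triadic_grid_def by auto

lemma floor_triadic_parent:
  "\<lfloor>x / 3 powr (of_int (k + int j)) - half_shift A i\<rfloor> = \<lfloor>y / 3 powr (of_int (k + int j)) - half_shift A i\<rfloor>"
  if "\<lfloor>x / 3 powr of_int k - half_shift A i\<rfloor> = \<lfloor>y / 3 powr of_int k - half_shift A i\<rfloor>"
proof (induction j)
  case (Suc j)
  define a :: int where "a = (if i \<in> A then 1 else 0)"
  define L where "L = (3::real) powr of_int (k + int j)"
  have L: "3 powr of_int (k + int (Suc j)) = 3 * L"
    unfolding L_def by (simp add: powr_add)
  \<comment> \<open>The index at the next scale is a function of the index alone, because a/2 = (a/2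
    + a) / 3.\<close>
  have *: "\<lfloor>z / (3 * L) - half_shift A i\<rfloor> = (\<lfloor>z / L - half_shift A i\<rfloor> - a) div 3" for z
  proof -
    have "z / (3 * L) - half_shift A i = ((z / L - half_shift A i) - of_int a) / of_int 3"
      by (simp add: half_shift_def a_def field_simps)
    then have "\<lfloor>z / (3 * L) - half_shift A i\<rfloor> = \<lfloor>((z / L - half_shift A i) - of_int a) / of_int 3\<rfloor>"
      by (rule arg_cong)
    also have "\<dots> = \<lfloor>(z / L - half_shift A i) - of_int a\<rfloor> div 3"
      by (rule floor_divide_real_eq_div) simp
    finally show ?thesis by simp
  qed
  show ?case
    unfolding L * using Suc by (simp add: L_def)
qed (use that in simp)

lemma triadic_cell_nested:
  assumes "k \<le> l" "z \<in> triadic_cell A k m" "z \<in> triadic_cell A l n"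
  shows "triadic_cell A k m \<subseteq> triadic_cell A l n"
proof
  fix x assume x: "x \<in> triadic_cell A k m"
  obtain j where l: "l = k + int j"
    using zle_iff_zadd[of k l] assms(1) by auto
  show "x \<in> triadic_cell A l n"
    unfolding triadic_cell_def
  proof safe
    fix i
    have "\<lfloor>x $ i / 3 powr of_int k - half_shift A i\<rfloor> = \<lfloor>z $ i / 3 powr of_int k - half_shift A i\<rfloor>"
      using x assms(2) by (simp add: triadic_cell_def)
    from floor_triadic_parent[OF this, of j] show "\<lfloor>x $ i / 3 powr of_int l - half_shift A i\<rfloor> = n i"
      using assms(3) by (simp add: l triadic_cell_def)
  qed
qed

lemma laminar_triadic_grid: "laminar (triadic_grid A)"
  unfolding laminar_def
proof (intro ballI)
  fix P Q assume "P \<in> triadic_grid A" "Q \<in> triadic_grid A"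
  then obtain k m l n where P: "P = triadic_cell A k m" and Q: "Q = triadic_cell A l n"
    by (auto simp: triadic_grid_def)
  show "P \<inter> Q = {} \<or> P \<subseteq> Q \<or> Q \<subseteq> P"
  proof (cases "P \<inter> Q = {}")
    case False
    then obtain z where "z \<in> triadic_cell A k m" "z \<in> triadic_cell A l n"
      unfolding P Q by blast
    then show ?thesis
      unfolding P Q using triadic_cell_nested[of k l z A m n] triadic_cell_nested[of l k z A n m] by linarith
  qed simp
qed

lemma emeasure_cube:
  assumes "0 \<le> l"
  shows "emeasure lebesgue (cbox c (c + (\<chi> i. l)) :: (real ^ 'n) set) = ennreal (l ^ CARD('n))"
proof -
  have "(\<chi> i. l) \<bullet> b = l" if "b \<in> Basis" for b :: "real ^ 'n"
    using that by (auto simp: Basis_vec_def inner_axis)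
  then show ?thesis
    using assms by (simp add: emeasure_lborel_cbox_eq inner_add_left)
qed

lemma emeasure_triadic_cell_le:
  "emeasure lebesgue (triadic_cell A k m :: (real ^ 'n) set) \<le> ennreal ((3 powr of_int k) ^ CARD('n))"
proof -
  let ?L = "3 powr of_int k :: real"
  let ?c = "\<chi> i. (of_int (m i) + half_shift A i) * ?L"
  have "triadic_cell A k m \<subseteq> cbox ?c (?c + (\<chi> i. ?L))"
  proof
    fix x assume x: "x \<in> triadic_cell A k m"
    have "?c $ i \<le> x $ i \<and> x $ i \<le> (?c + (\<chi> i. ?L)) $ i" for i
    proof -
      have "\<lfloor>x $ i / ?L - half_shift A i\<rfloor> = m i" using x by (simp add: triadic_cell_def)
      then have "of_int (m i) \<le> x $ i / ?L - half_shift A i" "x $ i / ?L - half_shift A i \<le> of_int (m i) + 1"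
        by linarith+
      then show ?thesis by (simp add: field_simps)
    qed
    then show "x \<in> cbox ?c (?c + (\<chi> i. ?L))" by (simp add: mem_box_cart)
  qed
  then have "emeasure lebesgue (triadic_cell A k m) \<le> emeasure lebesgue (cbox ?c (?c + (\<chi> i. ?L)))"
    by (intro emeasure_mono) auto
  then show ?thesis by (subst (asm) emeasure_cube) auto
qed

text \<open>If the floors differ, N = \<lfloor>b\<rfloor> lies in (a, b]; as the length is below
  1/2, subtracting 1/2 moves both ends into [N - 1, N).\<close>

lemma floor_eq_of_short_interval:
  assumes "a \<le> b" "b - a < 1 / 2"
  shows "\<lfloor>a :: real\<rfloor> = \<lfloor>b\<rfloor> \<or> \<lfloor>a - 1 / 2\<rfloor> = \<lfloor>b - 1 / 2\<rfloor>"
proof (cases "\<lfloor>a\<rfloor> = \<lfloor>b\<rfloor>")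
  case False
  moreover have "\<lfloor>a\<rfloor> \<le> \<lfloor>b\<rfloor>" using assms(1) by (rule floor_mono)
  ultimately have "a < of_int \<lfloor>b\<rfloor>" by linarith
  then have "\<lfloor>a - 1 / 2\<rfloor> = \<lfloor>b\<rfloor> - 1" "\<lfloor>b - 1 / 2\<rfloor> = \<lfloor>b\<rfloor> - 1"
    using assms of_int_floor_le[of b] by (intro floor_unique; simp; linarith)+
  then show ?thesis by simp
qed simp

lemma cube_subset_triadic_cell:
  assumes "Q \<in> (cubes :: (real ^ 'n) set set)"
  obtains A P where "P \<in> triadic_grid A" "Q \<subseteq> P" "emeasure lebesgue P \<le> ennreal (6 ^ CARD('n)) * emeasure lebesgue Q"
proof -
  obtain c :: "real ^ 'n" and l where Q: "Q = cbox c (c + (\<chi> i. l))" and l: "0 < l"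
    using assms unfolding cubes_def by blast
  \<comment> \<open>The least power of 3 above 2l: it makes the scaled edges shorter than 1/2 and is
    at most 6l, the origin of 6^n.\<close>
  define k where "k = \<lfloor>log 3 (2 * l)\<rfloor> + 1"
  let ?L = "3 powr of_int k :: real"
  have "2 * l = 3 powr log 3 (2 * l)" using l by simp
  also have "\<dots> < ?L"
    unfolding k_def by (intro powr_less_mono) linarith+
  finally have lo: "2 * l < ?L" .
  have "?L \<le> 3 powr (log 3 (2 * l) + 1)"
    unfolding k_def by (intro powr_mono) linarith+
  also have "\<dots> = 6 * l" using l by (simp add: powr_add)
  finally have hi: "?L \<le> 6 * l" .
  \<comment> \<open>Exactly the coordinates in which an endpoint of the unshifted intervals
    separates the ends of the edge are shifted.\<close>
  define A where "A = {i. \<lfloor>c $ i / ?L\<rfloor> \<noteq> \<lfloor>(c $ i + l) / ?L\<rfloor>}"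
  define m where "m i = \<lfloor>c $ i / ?L - half_shift A i\<rfloor>" for i
  have ends: "\<lfloor>(c $ i + l) / ?L - half_shift A i\<rfloor> = m i" for i
  proof -
    have "c $ i / ?L \<le> (c $ i + l) / ?L" "(c $ i + l) / ?L - c $ i / ?L < 1 / 2"
      using l lo by (auto simp: field_simps)
    from floor_eq_of_short_interval[OF this] show ?thesis
      by (auto simp: m_def half_shift_def A_def)
  qed
  have "Q \<subseteq> triadic_cell A k m"
  proof
    fix x assume "x \<in> Q"
    then have x: "c $ i \<le> x $ i" "x $ i \<le> c $ i + l" for i
      by (auto simp: Q mem_box_cart)
    have "\<lfloor>x $ i / ?L - half_shift A i\<rfloor> = m i" for i
    proof (rule antisym)
      have "\<lfloor>x $ i / ?L - half_shift A i\<rfloor> \<le> \<lfloor>(c $ i + l) / ?L - half_shift A i\<rfloor>"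
        using x[of i] by (intro floor_mono diff_right_mono divide_right_mono) auto
      then show "\<lfloor>x $ i / ?L - half_shift A i\<rfloor> \<le> m i" by (simp only: ends)
      show "m i \<le> \<lfloor>x $ i / ?L - half_shift A i\<rfloor>"
        unfolding m_def using x[of i] by (intro floor_mono diff_right_mono divide_right_mono) auto
    qed
    then show "x \<in> triadic_cell A k m" by (simp add: triadic_cell_def)
  qed
  moreover have "emeasure lebesgue (triadic_cell A k m) \<le> ennreal (6 ^ CARD('n)) * emeasure lebesgue Q"
  proof -
    have "emeasure lebesgue (triadic_cell A k m) \<le> ennreal (?L ^ CARD('n))"
      by (rule emeasure_triadic_cell_le)
    also have "\<dots> \<le> ennreal ((6 * l) ^ CARD('n))"
      using hi by (intro ennreal_leI power_mono) auto
    also have "\<dots> = ennreal (6 ^ CARD('n)) * emeasure lebesgue Q"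
      unfolding Q emeasure_cube[OF less_imp_le[OF l]] using l
      by (simp only: power_mult_distrib) (simp add: ennreal_mult)
    finally show ?thesis .
  qed
  moreover have "triadic_cell A k m \<in> triadic_grid A"
    by (auto simp: triadic_grid_def)
  ultimately show ?thesis by (intro that)
qed

text \<open>The grid that serves a cube depends on the cube, so s must bound all grids at x. A free
  s can be a level or an \<ell>^q sum over the grids.\<close>

lemma maximal_fun_le:
  fixes f :: "real ^ 'n \<Rightarrow> complex"
  assumes "\<And>A. max_over (triadic_grid A) lebesgue (\<lambda>y. ennreal (cmod (f y))) x \<le> s"
  shows "maximal_fun f x \<le> ennreal (6 ^ CARD('n)) * s"
  unfolding maximal_fun_def
proof (rule SUP_least)
  fix Q :: "(real ^ 'n) set" assume Q: "Q \<in> cubes"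
  let ?g = "\<lambda>y. ennreal (cmod (f y))" and ?K = "ennreal (6 ^ CARD('n))"
  show "indicator Q x / emeasure lebesgue Q * (\<integral>\<^sup>+ y\<in>Q. ?g y \<partial>lebesgue) \<le> ?K * s"
  proof (cases "x \<in> Q")
    case True
    obtain A P where P: "P \<in> triadic_grid A" "Q \<subseteq> P" "emeasure lebesgue P \<le> ?K * emeasure lebesgue Q"
      using cube_subset_triadic_cell[OF Q] by metis
    obtain a where a: "emeasure lebesgue Q = ennreal a" "0 < a"
      using Q emeasure_cube zero_less_power less_imp_le unfolding cubes_def by (smt (verit) mem_Collect_eq)
    have P_meas: "P \<in> sets lebesgue" using P triadic_grid_sets by auto
    have "emeasure lebesgue P \<le> ennreal (6 ^ CARD('n) * a)"
      using P(3) a by (simp add: ennreal_mult)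
    then obtain b where b: "emeasure lebesgue P = ennreal b" "0 \<le> b" "b \<le> 6 ^ CARD('n) * a"
      using a by (cases "emeasure lebesgue P") (auto simp: top_unique)
    \<comment> \<open>P contains Q and so has positive measure; its average is a genuine quotient
      and not the default 0.\<close>
    have "ennreal a \<le> ennreal b"
      using emeasure_mono[OF P(2) P_meas] by (simp add: a b)
    then have "a \<le> b" using b by simp
    then have "inverse (ennreal a) \<le> ?K * inverse (ennreal b)"
      using a b by (simp add: inverse_ennreal ennreal_mult[symmetric] field_simps)
    moreover have "(\<integral>\<^sup>+ y\<in>Q. ?g y \<partial>lebesgue) \<le> (\<integral>\<^sup>+ y\<in>P. ?g y \<partial>lebesgue)"
      using P(2) by (intro nn_integral_mono) (auto simp: indicator_def)
    ultimately have "inverse (ennreal a) * (\<integral>\<^sup>+ y\<in>Q. ?g y \<partial>lebesgue) \<le> ?K * inverse (ennreal b) * (\<integral>\<^sup>+ y\<in>P. ?g y \<partial>lebesgue)"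
      by (rule mult_mono) auto
    also have "\<dots> = ?K * average lebesgue ?g P"
      by (simp add: average_def b divide_ennreal_def mult_ac)
    also have "\<dots> \<le> ?K * s"
      using P True assms[of A] average_le_max_over[OF P(1), of x lebesgue ?g]
      by (intro mult_left_mono) (auto intro: order_trans)
    finally show ?thesis using True by (simp add: a divide_ennreal_def)
  qed simp
qed


subsection \<open>Weak Orlicz norms\<close>

lemma sigma_finite_lebesgue: "sigma_finite_measure (lebesgue :: 'a::euclidean_space measure)"
proof
  obtain A :: "'a set set" where A: "countable A" "A \<subseteq> sets lborel" "\<Union>A = space lborel" "\<forall>a\<in>A. emeasure lborel a \<noteq> \<infinity>"
    using lborel.sigma_finite_countable by blast
  then have "emeasure lebesgue a = emeasure lborel a" if "a \<in> A" for a
    using that by (intro emeasure_completion[THEN trans]) (auto intro: main_part_sets)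
  with A show "\<exists>A :: 'a set set. countable A \<and> A \<subseteq> sets lebesgue \<and> \<Union>A = space lebesgue \<and> (\<forall>a\<in>A. emeasure lebesgue a \<noteq> \<infinity>)"
    by (intro exI[of _ A]) auto
qed

lemma less_divide_ennreal_iff:
  assumes "0 < l"
  shows "ennreal t < y / ennreal l \<longleftrightarrow> ennreal (l * t) < y"
proof (cases y)
  case (real r)
  then show ?thesis
    using assms by (cases "0 \<le> t") (auto simp: divide_ennreal ennreal_less_iff ennreal_neg mult_nonneg_nonpos field_simps zero_less_divide_iff)
next
  case top
  then show ?thesis by (simp add: ennreal_top_divide)
qed

text \<open>The scaling by l moves from the function to \<Phi>. The level sets no longer depend on
  l, and for fixed l everything concerns the function \<Phi>(t / l) of t.\<close>

lemma weak_orlicz_norm_alt: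
  "weak_orlicz_norm \<Phi> g = Inf {ennreal l | l. 0 < l \<and>
     (\<forall>t>0. \<Phi> (ennreal (t / l)) * emeasure lebesgue {x. ennreal t < g x} \<le> 1)}"
proof -
  have "(SUP t\<in>{0<..}. \<Phi> (ennreal t) * distrib_fun (\<lambda>x. g x / ennreal l) t) \<le> 1
      \<longleftrightarrow> (\<forall>t>0. \<Phi> (ennreal (t / l)) * emeasure lebesgue {x. ennreal t < g x} \<le> 1)" (is "?L \<longleftrightarrow> ?R")
    if l: "0 < l" for l
  proof
    assume L: ?L
    show ?R
    proof safe
      fix t :: real assume "0 < t"
      then have "\<Phi> (ennreal (t / l)) * distrib_fun (\<lambda>x. g x / ennreal l) (t / l) \<le> 1"
        using L l by (auto simp: SUP_le_iff)
      then show "\<Phi> (ennreal (t / l)) * emeasure lebesgue {x. ennreal t < g x} \<le> 1"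
        using l by (simp add: distrib_fun_def less_divide_ennreal_iff)
    qed
  next
    assume R: ?R
    show ?L
    proof (rule SUP_least)
      fix t :: real assume "t \<in> {0<..}"
      then have "0 < l * t" using l by simp
      from R[rule_format, OF this] show "\<Phi> (ennreal t) * distrib_fun (\<lambda>x. g x / ennreal l) t \<le> 1"
        using l by (simp add: distrib_fun_def less_divide_ennreal_iff)
    qed
  qed
  then show ?thesis
    unfolding weak_orlicz_norm_def by (intro arg_cong[of _ _ Inf]) auto
qed

text \<open>If l is admissible for F, then b k^i l is admissible for G: the i further scalings by k
  divide S by (2k)^i.\<close>

lemma weak_orlicz_norm_le_of_level_bound:
  assumes nabla: "\<And>r. 0 < r \<Longrightarrow> ennreal (2 * k) * \<Phi> (ennreal r) \<le> \<Phi> (ennreal (k * r))" and k: "1 < k"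
    and b: "0 < b" and S: "0 \<le> S" "S \<le> (2 * k) ^ i"
    and bound: "\<And>l t. 0 < l \<Longrightarrow>
      (\<And>t. 0 < t \<Longrightarrow> \<Phi> (ennreal (t / l)) * emeasure lebesgue {x. ennreal t < F x} \<le> 1) \<Longrightarrow> 0 < t \<Longrightarrow>
      \<Phi> (ennreal (t / l)) * emeasure lebesgue {x. ennreal (b * t) < G x} \<le> ennreal S"
  shows "weak_orlicz_norm \<Phi> G \<le> ennreal (b * k ^ i) * weak_orlicz_norm \<Phi> F"
proof -
  define C where "C = b * k ^ i"
  have C: "0 < C" using b k by (simp add: C_def)
  \<comment> \<open>Division by C turns the claim into a lower bound for an infimum, which includes
    the infimum of the empty set.\<close>
  have "weak_orlicz_norm \<Phi> G / ennreal C \<le> weak_orlicz_norm \<Phi> F"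
    unfolding weak_orlicz_norm_alt[of \<Phi> F]
  proof (rule Inf_greatest)
    fix y assume "y \<in> {ennreal l | l. 0 < l \<and>
      (\<forall>t>0. \<Phi> (ennreal (t / l)) * emeasure lebesgue {x. ennreal t < F x} \<le> 1)}"
    then obtain l where y: "y = ennreal l" and l: "0 < l"
      and level: "\<And>t. 0 < t \<Longrightarrow> \<Phi> (ennreal (t / l)) * emeasure lebesgue {x. ennreal t < F x} \<le> 1"
      by blast
    let ?m = "\<lambda>t. emeasure lebesgue {x. ennreal (b * t) < G x}"
    have *: "\<Phi> (ennreal (t / l)) * ?m (k ^ i * t) \<le> 1" if "0 < t" for t
    proof -
      have "\<Phi> (ennreal (t / l)) * ?m (k ^ i * t) \<le> ennreal (S / (2 * k) ^ i)"
      proof (rule growth_amplify[where \<phi> = "\<lambda>t. \<Phi> (ennreal (t / l))" and m = ?m])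
        show "ennreal (2 * k) * \<Phi> (ennreal (r / l)) \<le> \<Phi> (ennreal (k * r / l))" if "0 < r" for r
          using nabla[of "r / l"] that l by simp
      qed (use k S that bound[OF l level] in auto)
      also have "\<dots> \<le> ennreal 1"
        using S k by (intro ennreal_leI) (simp add: field_simps)
      finally show ?thesis by simp
    qed
    have "\<Phi> (ennreal (t / (C * l))) * emeasure lebesgue {x. ennreal t < G x} \<le> 1" if "0 < t" for t
    proof -
      have "t / (C * l) = t / C / l" "b * (k ^ i * (t / C)) = t"
        using b k by (auto simp: C_def)
      then show ?thesis
        using *[of "t / C"] that C by simp
    qed
    then have "weak_orlicz_norm \<Phi> G \<le> ennreal (C * l)"
      unfolding weak_orlicz_norm_alt[of \<Phi> G] using C l by (intro Inf_lower) auto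
    then show "weak_orlicz_norm \<Phi> G / ennreal C \<le> y"
      using C l by (intro divide_le_posI_ennreal) (auto simp: y ennreal_mult)
  qed
  then have "ennreal C * (weak_orlicz_norm \<Phi> G / ennreal C) \<le> ennreal C * weak_orlicz_norm \<Phi> F"
    by (rule mult_left_mono) simp
  moreover have "ennreal C * (weak_orlicz_norm \<Phi> G / ennreal C) = weak_orlicz_norm \<Phi> G"
    using C by (simp add: ennreal_times_divide mult.commute[of "ennreal C"] mult_divide_eq_ennreal)
  ultimately show ?thesis by (simp add: C_def)
qed

text \<open>Measurability rests on the covering sets alone. The level sets of
  \<open>maximal_fun\<close>, a supremum over uncountably many cubes, can thus be bounded without a
  measurability proof.\<close>

lemma level_bound_UN:
  assumes "finite I" "U \<subseteq> (\<Union>i\<in>I. V i)" "\<And>i. i \<in> I \<Longrightarrow> V i \<in> sets M"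
    and "\<And>i. i \<in> I \<Longrightarrow> c * emeasure M (V i) \<le> ennreal S" "0 \<le> S"
  shows "c * emeasure M U \<le> ennreal (real (card I) * S)"
proof -
  have "emeasure M U \<le> emeasure M (\<Union>i\<in>I. V i)"
    using assms by (intro emeasure_mono sets.finite_UN) auto
  also have "\<dots> \<le> (\<Sum>i\<in>I. emeasure M (V i))"
    using assms by (intro emeasure_subadditive_finite) auto
  finally have "c * emeasure M U \<le> (\<Sum>i\<in>I. c * emeasure M (V i))"
    by (simp add: sum_distrib_left[symmetric] mult_left_mono)
  also have "\<dots> \<le> (\<Sum>i\<in>I. ennreal S)"
    using assms by (intro sum_mono) auto
  also have "\<dots> = ennreal (real (card I) * S)"
    using assms(5) by (simp add: ennreal_mult ennreal_of_nat_eq_real_of_nat)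
  finally show ?thesis .
qed

section \<open>From the grids back to cubes\<close>

lemma max_over_mono:
  assumes "\<And>x. f x \<le> g x"
  shows "max_over D M f x \<le> max_over D M g x"
  unfolding max_over_def average_def using assms
  by (intro SUP_mono' mult_right_mono divide_right_mono_ennreal nn_integral_mono) auto

text \<open>Every |f_j| is at most the supremum F, so a point where all grid maximal functions of F
  are at most 2t is controlled for all j at once.\<close>

lemma sup_maximal_fun_level_bound:
  fixes f :: "nat \<Rightarrow> real ^ 'n \<Rightarrow> complex" and \<phi> :: "real \<Rightarrow> ennreal"
  assumes nabla: "\<And>r. 0 < r \<Longrightarrow> ennreal (2 * k) * \<phi> r \<le> \<phi> (k * r)" and k: "1 < k"
    and f [measurable]: "\<And>j. f j \<in> borel_measurable lebesgue"
    and level: "\<And>t. 0 < t \<Longrightarrow> \<phi> t * emeasure lebesgue {x. ennreal t < (SUP j. ennreal (cmod (f j x)))} \<le> 1"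
    and t: "0 < t"
  shows "\<phi> t * emeasure lebesgue {x. ennreal (6 ^ CARD('n) * 2 * t) < (SUP j. maximal_fun (f j) x)}
    \<le> ennreal (real CARD('n set) * (2 * k))"
proof (rule level_bound_UN)
  define F where "F x = (SUP j. ennreal (cmod (f j x)))" for x
  have F [measurable]: "F \<in> borel_measurable lebesgue" unfolding F_def by measurable
  let ?B = "\<lambda>A. {x \<in> space lebesgue. ennreal (2 * t) < max_over (triadic_grid A) lebesgue F x}"
  note [measurable] = borel_measurable_max_over[OF countable_triadic_grid triadic_grid_sets]
  show "{x. ennreal (6 ^ CARD('n) * 2 * t) < (SUP j. maximal_fun (f j) x)} \<subseteq> (\<Union>A\<in>UNIV. ?B A)"
  proof (rule subsetI, rule ccontr)
    fix x
    assume x: "x \<in> {x. ennreal (6 ^ CARD('n) * 2 * t) < (SUP j. maximal_fun (f j) x)}" and "x \<notin> (\<Union>A\<in>UNIV. ?B A)"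
    then have small: "max_over (triadic_grid A) lebesgue F x \<le> ennreal (2 * t)" for A
      by (simp add: not_less)
    have "maximal_fun (f j) x \<le> ennreal (6 ^ CARD('n)) * ennreal (2 * t)" for j
    proof (rule maximal_fun_le)
      fix A :: "'n set"
      have "max_over (triadic_grid A) lebesgue (\<lambda>y. ennreal (cmod (f j y))) x \<le> max_over (triadic_grid A) lebesgue F x"
        unfolding F_def by (intro max_over_mono SUP_upper) auto
      also note small
      finally show "max_over (triadic_grid A) lebesgue (\<lambda>y. ennreal (cmod (f j y))) x \<le> ennreal (2 * t)" .
    qed
    then have "(SUP j. maximal_fun (f j) x) \<le> ennreal (6 ^ CARD('n)) * ennreal (2 * t)"
      by (rule SUP_least)
    also have "\<dots> = ennreal (6 ^ CARD('n) * 2 * t)"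
      using t by (simp add: ennreal_mult[symmetric] mult.assoc)
    finally show False using x by simp
  qed
  show "?B A \<in> sets lebesgue" for A by measurable
  show "\<phi> t * emeasure lebesgue (?B A) \<le> ennreal (2 * k)" for A
    using level t
    by (intro max_over_level_bound nabla k countable_triadic_grid triadic_grid_sets laminar_triadic_grid F)
      (simp_all add: F_def)
qed (use k in auto)

lemma lq_maximal_fun_level_bound:
  fixes f :: "nat \<Rightarrow> real ^ 'n \<Rightarrow> complex" and \<phi> :: "real \<Rightarrow> ennreal" and q p c :: real
  defines "C \<equiv> \<lambda>r::real. r * 2 powr r / (r - 1)"
  assumes nabla: "\<And>r. 0 < r \<Longrightarrow> ennreal (2 * k) * \<phi> r \<le> \<phi> (k * r)" and k: "1 < k"
    and doubling: "\<And>r. 0 < r \<Longrightarrow> \<phi> (2 * r) \<le> ennreal d * \<phi> r" and d: "1 < d"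
    and q: "1 < q" and p: "1 < p" "2 * d \<le> 2 powr (q * p)"
    and c: "c = 3 * (C q * (2 * C (p / (p - 1)) + 1)) powr (1 / q)"
    and f [measurable]: "\<And>j. f j \<in> borel_measurable lebesgue"
    and level: "\<And>t. 0 < t \<Longrightarrow> \<phi> t * emeasure lebesgue
      {x. ennreal t < epowr (\<Sum>j. epowr (ennreal (cmod (f j x))) q) (1 / q)} \<le> 1"
    and t: "0 < t"
  shows "\<phi> t * emeasure lebesgue {x. ennreal (6 ^ CARD('n) * real CARD('n set) * c * t)
      < epowr (\<Sum>j. epowr (maximal_fun (f j) x) q) (1 / q)}
    \<le> ennreal (real CARD('n set) * (6 * k + 4 * d + 1))"
proof (rule level_bound_UN)
  let ?m = "\<lambda>A j. max_over (triadic_grid A) lebesgue (\<lambda>y. ennreal (cmod (f j y)))"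
  let ?K = "6 ^ CARD('n) :: real" and ?N = "real CARD('n set)"
  let ?W = "\<lambda>A. {x \<in> space lebesgue. ennreal ((c * t) powr q) < (\<Sum>j. epowr (?m A j x) q)}"
  note [measurable] = borel_measurable_max_over[OF countable_triadic_grid triadic_grid_sets]
  have c0: "0 \<le> c" unfolding c by simp
  have N: "1 \<le> ?N" by (simp add: Suc_le_eq card_gt_0_iff)
  show "{x. ennreal (?K * ?N * c * t) < epowr (\<Sum>j. epowr (maximal_fun (f j) x) q) (1 / q)} \<subseteq> (\<Union>A\<in>UNIV. ?W A)"
  proof (rule subsetI, rule ccontr)
    fix x
    assume x: "x \<in> {x. ennreal (?K * ?N * c * t) < epowr (\<Sum>j. epowr (maximal_fun (f j) x) q) (1 / q)}"
      and "x \<notin> (\<Union>A\<in>UNIV. ?W A)"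
    then have small: "(\<Sum>j. epowr (?m A j x) q) \<le> ennreal ((c * t) powr q)" for A
      by (simp add: not_less)
    \<comment> \<open>The maximum over the grids is replaced by an \<ell>^q sum, which can be
      interchanged with the sum over j.\<close>
    have mj: "epowr (maximal_fun (f j) x) q \<le> ennreal (?K powr q) * (\<Sum>A\<in>UNIV. epowr (?m A j x) q)" for j
    proof -
      let ?s = "epowr (\<Sum>A\<in>UNIV. epowr (?m A j x) q) (1 / q)"
      have "?m A j x \<le> ?s" for A
        using q member_le_sum[of A UNIV "\<lambda>A. epowr (?m A j x) q"] by (simp add: epowr_le_iff[symmetric])
      then have "maximal_fun (f j) x \<le> ennreal ?K * ?s"
        by (rule maximal_fun_le)
      then have "epowr (maximal_fun (f j) x) q \<le> epowr (ennreal ?K * ?s) q"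
        using q by (intro epowr_mono) auto
      also have "\<dots> = ennreal (?K powr q) * (\<Sum>A\<in>UNIV. epowr (?m A j x) q)"
        using q by (simp add: epowr_mult epowr_epowr)
      finally show ?thesis .
    qed
    have "(\<Sum>j. epowr (maximal_fun (f j) x) q) \<le> (\<Sum>j. ennreal (?K powr q) * (\<Sum>A\<in>UNIV. epowr (?m A j x) q))"
      by (intro suminf_le mj) auto
    also have "\<dots> = ennreal (?K powr q) * (\<Sum>A\<in>UNIV. \<Sum>j. epowr (?m A j x) q)"
      by (simp add: suminf_sum)
    also have "\<dots> \<le> ennreal (?K powr q) * (\<Sum>A\<in>(UNIV :: 'n set set). ennreal ((c * t) powr q))"
      by (intro mult_left_mono sum_mono small) auto
    also have "\<dots> = ennreal (?K powr q * ?N * (c * t) powr q)"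
      by (simp add: ennreal_mult ennreal_of_nat_eq_real_of_nat mult.assoc)
    \<comment> \<open>As N \<ge> 1, N is at most N^q, and the whole bound becomes a q-th
      power.\<close>
    also have "\<dots> \<le> ennreal (?K powr q * ?N powr q * (c * t) powr q)"
      using N q powr_mono[of 1 q ?N] by (intro ennreal_leI mult_mono) auto
    also have "\<dots> = epowr (ennreal (?K * ?N * c * t)) q"
      using c0 t by (simp add: powr_mult mult.assoc)
    finally have "epowr (\<Sum>j. epowr (maximal_fun (f j) x) q) (1 / q) \<le> epowr (epowr (ennreal (?K * ?N * c * t)) q) (1 / q)"
      using q by (intro epowr_mono) auto
    then show False using x q by (simp add: epowr_epowr)
  qed
  show "?W A \<in> sets lebesgue" for A by measurable
  show "\<phi> t * emeasure lebesgue (?W A) \<le> ennreal (6 * k + 4 * d + 1)" for A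
    using nabla k doubling d q p c level t unfolding C_def
    by (intro vector_max_over_weak_bound[where p = p] sigma_finite_lebesgue
        countable_triadic_grid triadic_grid_sets laminar_triadic_grid) simp_all
qed (use k d in auto)

theorem theorem1p7:
  fixes \<Phi> :: "ennreal \<Rightarrow> ennreal" and q :: real
  assumes "young_function \<Phi>" and "1 < q"
  shows "(nabla2 \<Phi> \<longrightarrow>
            (\<exists>C::real. C > 0 \<and>
              (\<forall>f :: nat \<Rightarrow> real ^ 'n \<Rightarrow> complex. (\<forall>j. f j \<in> borel_measurable lebesgue) \<longrightarrow>
                 weak_orlicz_norm \<Phi> (\<lambda>x. SUP j. maximal_fun (f j) x)
                   \<le> ennreal C * weak_orlicz_norm \<Phi> (\<lambda>x. SUP j. ennreal (cmod (f j x)))))) \<and>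
         (Delta2 \<Phi> \<and> nabla2 \<Phi> \<longrightarrow>
            (\<exists>C::real. C > 0 \<and>
              (\<forall>f :: nat \<Rightarrow> real ^ 'n \<Rightarrow> complex. (\<forall>j. f j \<in> borel_measurable lebesgue) \<longrightarrow>
                 weak_orlicz_norm \<Phi> (\<lambda>x. epowr (\<Sum>j. epowr (maximal_fun (f j) x) q) (1 / q))
                   \<le> ennreal C *
                     weak_orlicz_norm \<Phi> (\<lambda>x. epowr (\<Sum>j. epowr (ennreal (cmod (f j x))) q) (1 / q)))))"
proof -
  let ?K = "6 ^ CARD('n) :: real" and ?N = "real CARD('n set)"
  have N: "0 < ?N" by (simp add: card_gt_0_iff)
  have nabla_growth: "ennreal (2 * k) * \<Phi> (ennreal r) \<le> \<Phi> (ennreal (k * r))"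
    if "1 < k" "\<forall>r\<ge>0. \<Phi> (ennreal r) \<le> ennreal (1 / (2 * k)) * \<Phi> (ennreal (k * r))" "0 < r" for k r :: real
  proof -
    have "ennreal (2 * k) * \<Phi> (ennreal r) \<le> ennreal (2 * k) * (ennreal (1 / (2 * k)) * \<Phi> (ennreal (k * r)))"
      using that by (intro mult_left_mono) auto
    also have "\<dots> = \<Phi> (ennreal (k * r))"
      using that by (simp add: mult.assoc[symmetric] ennreal_mult[symmetric])
    finally show ?thesis .
  qed
  have power_large: "\<exists>i. S \<le> (2 * k) ^ i" if "1 < k" for k S :: real
    using real_arch_pow[of "2 * k" S] that by (auto intro: less_imp_le)
  show ?thesis
  proof (intro conjI impI)
    assume "nabla2 \<Phi>"
    then obtain k where k: "1 < k" and nabla: "\<forall>r\<ge>0. \<Phi> (ennreal r) \<le> ennreal (1 / (2 * k)) * \<Phi> (ennreal (k * r))"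
      by (auto simp: nabla2_def)
    note growth = nabla_growth[OF k nabla]
    define S where "S = ?N * (2 * k)"
    obtain i where i: "S \<le> (2 * k) ^ i" using power_large[OF k] by blast
    show "\<exists>C>0. \<forall>f :: nat \<Rightarrow> real ^ 'n \<Rightarrow> complex. (\<forall>j. f j \<in> borel_measurable lebesgue) \<longrightarrow>
      weak_orlicz_norm \<Phi> (\<lambda>x. SUP j. maximal_fun (f j) x)
        \<le> ennreal C * weak_orlicz_norm \<Phi> (\<lambda>x. SUP j. ennreal (cmod (f j x)))"
    proof (intro exI[of _ "?K * 2 * k ^ i"] conjI allI impI)
      fix f :: "nat \<Rightarrow> real ^ 'n \<Rightarrow> complex" assume f: "\<forall>j. f j \<in> borel_measurable lebesgue"
      show "weak_orlicz_norm \<Phi> (\<lambda>x. SUP j. maximal_fun (f j) x)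
        \<le> ennreal (?K * 2 * k ^ i) * weak_orlicz_norm \<Phi> (\<lambda>x. SUP j. ennreal (cmod (f j x)))"
      proof (rule weak_orlicz_norm_le_of_level_bound[OF growth k _ _ i])
        fix l t :: real
        assume l: "0 < l" and level: "\<And>t. 0 < t \<Longrightarrow> \<Phi> (ennreal (t / l)) *
            emeasure lebesgue {x. ennreal t < (SUP j. ennreal (cmod (f j x)))} \<le> 1" and t: "0 < t"
        show "\<Phi> (ennreal (t / l)) * emeasure lebesgue {x. ennreal (?K * 2 * t) < (SUP j. maximal_fun (f j) x)} \<le> ennreal S"
          unfolding S_def
        \<comment> \<open>The growth condition is invariant under scaling of the argument, so the
          constants do not depend on l.\<close>
        proof (rule sup_maximal_fun_level_bound[where \<phi> = "\<lambda>t. \<Phi> (ennreal (t / l))"])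
          show "ennreal (2 * k) * \<Phi> (ennreal (r / l)) \<le> \<Phi> (ennreal (k * r / l))" if "0 < r" for r
            using growth[of "r / l"] that l by simp
        qed (use f k level t in auto)
      qed (use N k in \<open>auto simp: S_def\<close>)
    qed (use k in auto)
  next
    assume "Delta2 \<Phi> \<and> nabla2 \<Phi>"
    then obtain k d where k: "1 < k" and nabla: "\<forall>r\<ge>0. \<Phi> (ennreal r) \<le> ennreal (1 / (2 * k)) * \<Phi> (ennreal (k * r))"
      and d: "1 < d" and doubling: "\<forall>r>0. \<Phi> (ennreal (2 * r)) \<le> ennreal d * \<Phi> (ennreal r)"
      by (auto simp: nabla2_def Delta2_def)
    note growth = nabla_growth[OF k nabla]
    \<comment> \<open>Chosen so that 2^p = 2d: d > 1 gives p > 1, and q > 1 then gives the exponent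
      condition for q * p.\<close>
    define p where "p = log 2 (2 * d)"
    have p: "1 < p" using d by (simp add: p_def less_log_iff)
    have "2 * d = 2 powr p" using d by (simp add: p_def)
    also have "\<dots> \<le> 2 powr (q * p)" using p assms(2) by (intro powr_mono) auto
    finally have dp: "2 * d \<le> 2 powr (q * p)" .
    define C where "C = (\<lambda>r::real. r * 2 powr r / (r - 1))"
    define c where "c = 3 * (C q * (2 * C (p / (p - 1)) + 1)) powr (1 / q)"
    have "0 < C q" "0 < C (p / (p - 1))" using assms(2) p by (auto simp: C_def)
    then have "0 < C q * (2 * C (p / (p - 1)) + 1)" by (intro mult_pos_pos) auto
    then have "0 < (C q * (2 * C (p / (p - 1)) + 1)) powr (1 / q)" by (subst powr_gt_zero) linarith
    then have c: "0 < c" unfolding c_def by linarith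
    define S where "S = ?N * (6 * k + 4 * d + 1)"
    obtain i where i: "S \<le> (2 * k) ^ i" using power_large[OF k] by blast
    show "\<exists>C>0. \<forall>f :: nat \<Rightarrow> real ^ 'n \<Rightarrow> complex. (\<forall>j. f j \<in> borel_measurable lebesgue) \<longrightarrow>
      weak_orlicz_norm \<Phi> (\<lambda>x. epowr (\<Sum>j. epowr (maximal_fun (f j) x) q) (1 / q))
        \<le> ennreal C * weak_orlicz_norm \<Phi> (\<lambda>x. epowr (\<Sum>j. epowr (ennreal (cmod (f j x))) q) (1 / q))"
    proof (intro exI[of _ "?K * ?N * c * k ^ i"] conjI allI impI)
      fix f :: "nat \<Rightarrow> real ^ 'n \<Rightarrow> complex" assume f: "\<forall>j. f j \<in> borel_measurable lebesgue"
      show "weak_orlicz_norm \<Phi> (\<lambda>x. epowr (\<Sum>j. epowr (maximal_fun (f j) x) q) (1 / q))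
        \<le> ennreal (?K * ?N * c * k ^ i) * weak_orlicz_norm \<Phi> (\<lambda>x. epowr (\<Sum>j. epowr (ennreal (cmod (f j x))) q) (1 / q))"
      proof (rule weak_orlicz_norm_le_of_level_bound[OF growth k _ _ i])
        fix l t :: real
        assume l: "0 < l" and level: "\<And>t. 0 < t \<Longrightarrow> \<Phi> (ennreal (t / l)) * emeasure lebesgue
            {x. ennreal t < epowr (\<Sum>j. epowr (ennreal (cmod (f j x))) q) (1 / q)} \<le> 1" and t: "0 < t"
        show "\<Phi> (ennreal (t / l)) * emeasure lebesgue
            {x. ennreal (?K * ?N * c * t) < epowr (\<Sum>j. epowr (maximal_fun (f j) x) q) (1 / q)} \<le> ennreal S"
          unfolding S_def
        proof (rule lq_maximal_fun_level_bound[where \<phi> = "\<lambda>t. \<Phi> (ennreal (t / l))" and p = p])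
          show "ennreal (2 * k) * \<Phi> (ennreal (r / l)) \<le> \<Phi> (ennreal (k * r / l))" if "0 < r" for r
            using growth[of "r / l"] that l by simp
          show "\<Phi> (ennreal (2 * r / l)) \<le> ennreal d * \<Phi> (ennreal (r / l))" if "0 < r" for r
            using doubling[rule_format, of "r / l"] that l by simp
        qed (use f k d p dp assms(2) level t in \<open>auto simp: c_def C_def\<close>)
      qed (use N k d c in \<open>auto simp: S_def\<close>)
    qed (use k c N in auto)
  qed
qed

end
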